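(* Let $d=1$, and let $w:\mathbb Z\to[0,\infty)$ be symmetric ($w(r)=w(-r)$), normalised ($\sum_{r\in\mathbb Z}w(r)=1$), and bipartite, i.e. $w(r)=0$ for every even $r$ (including $r=0$); regard $w$ as the translation-invariant weight $w_{x,y}=w(y-x)$. Assume that $$\sum_{r\in\mathbb Z}|r|\,w(r)<\infty .$$ Let $L_{\max}:=\max_{x\in\mathbb T_L}|\mathcal L_x|$. Then there exist constants $\varepsilon,c>0$, depending only on $w$, such that, for every even $L$, $$\mathbb P^{\mathrm{mdd}}_{L,w}\bigl(L_{\max}\ge\varepsilon L\bigr)\ge c,\qquad \mathbb P^{\mathrm{mdd}}_{L,w}\bigl(|\mathcal L_0|\ge\varepsilon L\bigr)\ge\varepsilon c,\qquad M^{\mathrm{mdd}}_{L,w}\ge c .$$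
   Context: $\mathbb T_L:=\mathbb Z/L\mathbb Z$. The periodised weights on $\mathbb T_L$ are $w^{(L)}_{x,y}:=\sum_{k\in\mathbb Z}w(y-x+kL)$. Monomer double-dimer model (mdd). Let $V$ be a finite set with symmetric weights $w_{x,y}\ge0$, $x,y\in V$, and let $E$ be the set of unordered pairs $\{x,y\}$, $x\ne y$, with $w_{x,y}>0$. For $m\in\{0,1\}^E$ put $n_x(m):=\sum_{y:\{x,y\}\in E}m_{x,y}$. Let $\Omega$ be the set of $(m^1,m^2)\in\{0,1\}^E\times\{0,1\}^E$ with $n_x(m^1)=n_x(m^2)\in\{0,1\}$ for all $x\in V$. The measure $\mathbb P^{\mathrm{mdd}}$ on $\Omega$ gives $(m^1,m^2)$ probability proportional, with normalising constant $Z^{\mathrm{mdd}}$, to $\prod_{x\in V}w_{x,x}^{1-n_x(m^1)}\prod_{\{x,y\}\in E}w_{x,y}^{m^1_{x,y}+m^2_{x,y}}$ (with $0^0=1$; so when $w_{x,x}=0$ for all $x$ it is the law of two independent weighted perfect matchings). The multigraph in which $\{u,v\}\in E$ has multiplicity $m^1_{u,v}+m^2_{u,v}$ is a disjoint union of loops (possibly a doubled edge) and isolated vertices (monomers); $\mathcal L_x$ is the loop containing $x$ ($\mathcal L_x=\{x\}$ if $x$ is a monomer), and $|\mathcal L_x|$ is the total number of dimers (edges of $m^1$ and $m^2$, with multiplicity) in it. For $x\neq y$ let $\Omega_{x,y}$ be the set of $(m^1,m^2)\in\{0,1\}^E\times\{0,1\}^E$ with $n_z(m^1)=n_z(m^2)\in\{0,1\}$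 for $z\notin\{x,y\}$, $n_x(m^1)=n_y(m^1)=0$, $n_x(m^2)=n_y(m^2)=1$; then $$G^{\mathrm{mdd}}(x,y):=\frac1{Z^{\mathrm{mdd}}}\sum_{(m^1,m^2)\in\Omega_{x,y}}\ \prod_{z\in V\setminus\{x,y\}}w_{z,z}^{1-n_z(m^1)}\prod_{\{u,v\}\in E}w_{u,v}^{m^1_{u,v}+m^2_{u,v}},$$ and $G^{\mathrm{mdd}}(x,x):=0$. The subscript $_{L,w}$ means that the model is taken on $V=\mathbb T_L$ with weights $w^{(L)}$; $M^{\mathrm{mdd}}_{L,w}:=\frac1L\sum_{x\in\mathbb T_L}G^{\mathrm{mdd}}_{L,w}(0,x)$. *)

theory Defs
  imports "HOL-Probability.Probability"
begin

section \<open>The monomer double-dimer model\<close>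

text \<open>
  The model lives on a finite set \<open>V\<close> with symmetric weights \<open>W x y \<ge> 0\<close>. Unordered pairs are
  represented as two-element sets, and \<open>m \<in> {0,1}\<^sup>E\<close> as an extensional function on the edge
  set, so that each family corresponds to exactly one function.
\<close>

definition mdd_edges :: "'a set \<Rightarrow> ('a \<Rightarrow> 'a \<Rightarrow> real) \<Rightarrow> 'a set set" where
  "mdd_edges V W = {{x, y} | x y. x \<in> V \<and> y \<in> V \<and> x \<noteq> y \<and> W x y > 0}"

text \<open>Well defined on unordered pairs only because \<open>W\<close> is symmetric.\<close>

definition edge_weight :: "('a \<Rightarrow> 'a \<Rightarrow> real) \<Rightarrow> 'a set \<Rightarrow> real" where
  "edge_weight W e = (THE r. \<exists>x y. e = {x, y} \<and> r = W x y)"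

definition dimer_families :: "'a set \<Rightarrow> ('a \<Rightarrow> 'a \<Rightarrow> real) \<Rightarrow> ('a set \<Rightarrow> nat) set" where
  "dimer_families V W = mdd_edges V W \<rightarrow>\<^sub>E {0, 1}"

definition dimer_degree :: "'a set \<Rightarrow> ('a \<Rightarrow> 'a \<Rightarrow> real) \<Rightarrow> ('a set \<Rightarrow> nat) \<Rightarrow> 'a \<Rightarrow> nat" where
  "dimer_degree V W m x = (\<Sum>y | {x, y} \<in> mdd_edges V W. m {x, y})"

definition mdd_configs ::
    "'a set \<Rightarrow> ('a \<Rightarrow> 'a \<Rightarrow> real) \<Rightarrow> (('a set \<Rightarrow> nat) \<times> ('a set \<Rightarrow> nat)) set" where
  "mdd_configs V W =
    {(m1, m2) \<in> dimer_families V W \<times> dimer_families V W.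
       \<forall>x\<in>V. dimer_degree V W m1 x = dimer_degree V W m2 x \<and> dimer_degree V W m1 x \<in> {0, 1}}"

text \<open>
  The monomer factors range over a subset \<open>U\<close> of \<open>V\<close>: all of \<open>V\<close> for the partition function,
  and \<open>V - {x, y}\<close> for the two-point function. On the configurations below, degrees are at most
  \<open>1\<close>, so the subtraction in the exponent is not truncated.
\<close>

definition mdd_weight ::
    "'a set \<Rightarrow> ('a \<Rightarrow> 'a \<Rightarrow> real) \<Rightarrow> 'a set \<Rightarrow> ('a set \<Rightarrow> nat) \<times> ('a set \<Rightarrow> nat) \<Rightarrow> real" where
  "mdd_weight V W U = (\<lambda>(m1, m2).
     (\<Prod>z\<in>U. W z z ^ (1 - dimer_degree V W m1 z)) *
     (\<Prod>e\<in>mdd_edges V W. edge_weight W e ^ (m1 e + m2 e)))"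

definition mdd_partition :: "'a set \<Rightarrow> ('a \<Rightarrow> 'a \<Rightarrow> real) \<Rightarrow> real" where
  "mdd_partition V W = (\<Sum>\<omega>\<in>mdd_configs V W. mdd_weight V W V \<omega>)"

definition mdd_measure ::
    "'a set \<Rightarrow> ('a \<Rightarrow> 'a \<Rightarrow> real) \<Rightarrow> (('a set \<Rightarrow> nat) \<times> ('a set \<Rightarrow> nat)) measure" where
  "mdd_measure V W =
     point_measure (mdd_configs V W) (\<lambda>\<omega>. ennreal (mdd_weight V W V \<omega> / mdd_partition V W))"

text \<open>
  The loop containing \<open>x\<close>, given by its vertices, is the connected component of \<open>x\<close> in the
  multigraph with edge multiplicities \<open>m1 e + m2 e\<close>; it is \<open>{x}\<close> if \<open>x\<close> is a monomer. Its length
  counts dimers with multiplicity, so it is \<open>2\<close> for a doubled edge and \<open>0\<close> for a monomer.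
\<close>

definition mdd_loop ::
    "'a set \<Rightarrow> ('a \<Rightarrow> 'a \<Rightarrow> real) \<Rightarrow> ('a set \<Rightarrow> nat) \<times> ('a set \<Rightarrow> nat) \<Rightarrow> 'a \<Rightarrow> 'a set" where
  "mdd_loop V W = (\<lambda>(m1, m2) x.
     {y. (x, y) \<in> {(u, v). {u, v} \<in> mdd_edges V W \<and> m1 {u, v} + m2 {u, v} > 0}\<^sup>*})"

definition mdd_loop_length ::
    "'a set \<Rightarrow> ('a \<Rightarrow> 'a \<Rightarrow> real) \<Rightarrow> ('a set \<Rightarrow> nat) \<times> ('a set \<Rightarrow> nat) \<Rightarrow> 'a \<Rightarrow> nat" where
  "mdd_loop_length V W = (\<lambda>(m1, m2) x.
     \<Sum>e | e \<in> mdd_edges V W \<and> e \<subseteq> mdd_loop V W (m1, m2) x. m1 e + m2 e)"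

definition mdd_max_loop_length ::
    "'a set \<Rightarrow> ('a \<Rightarrow> 'a \<Rightarrow> real) \<Rightarrow> ('a set \<Rightarrow> nat) \<times> ('a set \<Rightarrow> nat) \<Rightarrow> nat" where
  "mdd_max_loop_length V W \<omega> = Max (mdd_loop_length V W \<omega> ` V)"

definition mdd_two_point_configs ::
    "'a set \<Rightarrow> ('a \<Rightarrow> 'a \<Rightarrow> real) \<Rightarrow> 'a \<Rightarrow> 'a \<Rightarrow> (('a set \<Rightarrow> nat) \<times> ('a set \<Rightarrow> nat)) set" where
  "mdd_two_point_configs V W x y =
    {(m1, m2) \<in> dimer_families V W \<times> dimer_families V W.
       (\<forall>z\<in>V - {x, y}. dimer_degree V W m1 z = dimer_degree V W m2 z \<and>
                        dimer_degree V W m1 z \<in> {0, 1}) \<and>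
       dimer_degree V W m1 x = 0 \<and> dimer_degree V W m1 y = 0 \<and>
       dimer_degree V W m2 x = 1 \<and> dimer_degree V W m2 y = 1}"

definition mdd_two_point :: "'a set \<Rightarrow> ('a \<Rightarrow> 'a \<Rightarrow> real) \<Rightarrow> 'a \<Rightarrow> 'a \<Rightarrow> real" where
  "mdd_two_point V W x y =
     (if x = y then 0
      else (\<Sum>\<omega>\<in>mdd_two_point_configs V W x y. mdd_weight V W (V - {x, y}) \<omega>) / mdd_partition V W)"


section \<open>The model on the discrete torus\<close>

text \<open>The torus is represented by the residues \<open>0, \<dots>, L - 1\<close>.\<close>

definition torus :: "nat \<Rightarrow> int set" where
  "torus L = {0..<int L}"

definition periodised_weight :: "(int \<Rightarrow> real) \<Rightarrow> nat \<Rightarrow> int \<Rightarrow> int \<Rightarrow> real" where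
  "periodised_weight w L x y = (\<Sum>\<^sub>\<infinity>k\<in>UNIV. w (y - x + k * int L))"

definition mdd_mean_two_point :: "nat \<Rightarrow> (int \<Rightarrow> real) \<Rightarrow> real" where
  "mdd_mean_two_point L w =
     (\<Sum>x\<in>torus L. mdd_two_point (torus L) (periodised_weight w L) 0 x) / real L"

end

theory Submission
  imports Defs
begin

text \<open>
  Since the weights are bipartite, the model is the law of two independent permutations \<open>\<sigma>, \<tau>\<close> (from
  even to odd sites), weighted by a circulant matrix \<open>A\<close>, and the loops are the cycles of \<open>inv \<tau> \<circ> \<sigma>\<close>;
  the two-point function is the ratio of a minor to the permanent.

  Exchanging \<open>\<sigma>\<close> and \<open>\<tau>\<close> along a cycle shows that the permanent of \<open>A\<close> with row \<open>p\<close> replaced by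
  row \<open>q\<close>, times the one with row \<open>q\<close> replaced by row \<open>p\<close>, is twice the weight of the pairs for
  which \<open>p\<close> and \<open>q\<close> lie on the same loop. By reflection symmetry the two factors are equal. Hence
  each of them is at most \<open>sqrt 2\<close> times the permanent, so that all two-point functions are bounded and
  the first moment controls the long dimers; and conversely connection probabilities bound the
  two-point function from below.

  The total displacement of a perfect matching is an odd multiple of half the length of the torus, and
  reflection reverses its sign. With probability bounded below, \<open>\<sigma>\<close> and \<open>\<tau>\<close> have displacements of
  opposite signs, and then some loop has nonzero winding. Such a loop has total displacement at
  least \<open>L\<close>, and as the long dimers contribute little, it has at least \<open>\<epsilon> L\<close> dimers.
\<close>

text \<open>Entries of the periodised matrix can be arbitrarily small, so a minor cannot be compared
  with the permanent through its own entry \<open>A i j\<close>. The bound on duplicated rows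
  removes this obstacle: the permanent with row \<open>k\<close> written over row \<open>i\<close>
  expands into the products \<open>A k j * minor i j\<close>, where \<open>k\<close> is free while
  the minors do not depend on it. Choosing \<open>k\<close> with \<open>A k j = a u \<ge> b\<close>,
  for one fixed odd displacement in the support of \<open>w\<close>, bounds every minor by
  \<open>sqrt 2 / b * per\<close>, uniformly in the size of the torus. Summing the same expansion
  over all \<open>k\<close>, with column sums 1, produces the lower bound on the two-point
  functions.

  The cut-off \<open>R\<close> is fixed once \<open>b\<close> is known: it makes the expected
  displacement carried by dimers longer than \<open>R\<close> at most \<open>N / 4\<close> on a
  torus of length \<open>2 * N\<close>. All remaining constants are functions of
  \<open>R\<close>.\<close>

subsection \<open>Permanents with a duplicated row\<close>

definition perm_weight :: "'a set \<Rightarrow> ('a \<Rightarrow> 'a \<Rightarrow> real) \<Rightarrow> ('a \<Rightarrow> 'a) \<Rightarrow> real" where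
  "perm_weight S A \<sigma> = (\<Prod>i\<in>S. A i (\<sigma> i))"

definition permanent :: "'a set \<Rightarrow> ('a \<Rightarrow> 'a \<Rightarrow> real) \<Rightarrow> real" where
  "permanent S A = (\<Sum>\<sigma> | \<sigma> permutes S. perm_weight S A \<sigma>)"

text \<open>Fixing \<open>\<sigma> i = j\<close> and omitting the factor at \<open>i\<close> encodes
  the deletion of row \<open>i\<close> and column \<open>j\<close> without re-indexing a smaller
  matrix.\<close>

definition permanent_minor :: "'a set \<Rightarrow> ('a \<Rightarrow> 'a \<Rightarrow> real) \<Rightarrow> 'a \<Rightarrow> 'a \<Rightarrow> real" where
  "permanent_minor S A i j = (\<Sum>\<sigma> | \<sigma> permutes S \<and> \<sigma> i = j. perm_weight (S - {i}) A \<sigma>)"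

text \<open>Equivalently, \<open>X\<close> is invariant under
  \<open>inv \<tau> \<circ> \<sigma>\<close>, a union of its cycles. For injective maps the
  condition passes to intersections and differences.\<close>

definition balanced :: "'a set \<Rightarrow> ('a \<Rightarrow> 'a) \<Rightarrow> ('a \<Rightarrow> 'a) \<Rightarrow> 'a set \<Rightarrow> bool" where
  "balanced S \<sigma> \<tau> X \<longleftrightarrow> X \<subseteq> S \<and> \<sigma> ` X = \<tau> ` X"

text \<open>
  The cycle of \<open>p\<close> under \<open>inv \<tau> \<circ> \<sigma>\<close>, described as a least set so that it is visibly symmetric
  in \<open>\<sigma>\<close> and \<open>\<tau>\<close>.
\<close>

definition cluster :: "'a set \<Rightarrow> ('a \<Rightarrow> 'a) \<Rightarrow> ('a \<Rightarrow> 'a) \<Rightarrow> 'a \<Rightarrow> 'a set" where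
  "cluster S \<sigma> \<tau> p = \<Inter>{X. balanced S \<sigma> \<tau> X \<and> p \<in> X}"

definition switch :: "'a set \<Rightarrow> ('a \<Rightarrow> 'a) \<Rightarrow> ('a \<Rightarrow> 'a) \<Rightarrow> 'a \<Rightarrow> 'a" where
  "switch X \<sigma> \<tau> = (\<lambda>i. if i \<in> X then \<tau> i else \<sigma> i)"

section \<open>Balanced sets, clusters and switching\<close>

lemma balanced_carrier: "\<sigma> permutes S \<Longrightarrow> \<tau> permutes S \<Longrightarrow> balanced S \<sigma> \<tau> S"
  by (simp add: balanced_def permutes_image)

lemma balanced_Int:
  assumes "\<sigma> permutes S" "\<tau> permutes S" "balanced S \<sigma> \<tau> X" "balanced S \<sigma> \<tau> Y"
  shows "balanced S \<sigma> \<tau> (X \<inter> Y)"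
  using assms by (auto simp: balanced_def image_Int[OF permutes_inj])

lemma balanced_Diff:
  assumes "\<sigma> permutes S" "\<tau> permutes S" "balanced S \<sigma> \<tau> X" "balanced S \<sigma> \<tau> Y"
  shows "balanced S \<sigma> \<tau> (X - Y)"
  using assms by (auto simp: balanced_def image_set_diff[OF permutes_inj])

lemma cluster_subset: "balanced S \<sigma> \<tau> X \<Longrightarrow> p \<in> X \<Longrightarrow> cluster S \<sigma> \<tau> p \<subseteq> X"
  by (auto simp: cluster_def)

lemma self_in_cluster: "p \<in> cluster S \<sigma> \<tau> p"
  by (auto simp: cluster_def)

lemma balanced_cluster:
  assumes "\<sigma> permutes S" "\<tau> permutes S" "p \<in> S"
  shows "balanced S \<sigma> \<tau> (cluster S \<sigma> \<tau> p)"
proof -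
  let ?F = "{X. balanced S \<sigma> \<tau> X \<and> p \<in> X}"
  have S: "S \<in> ?F" using assms balanced_carrier by blast
  have "\<sigma> ` (\<Inter>X\<in>?F. X) = (\<Inter>X\<in>?F. \<sigma> ` X)"
    by (rule image_INT[of \<sigma> UNIV]) (use S permutes_inj[OF assms(1)] in auto)
  also have "\<dots> = (\<Inter>X\<in>?F. \<tau> ` X)"
    by (auto simp: balanced_def)
  also have "\<dots> = \<tau> ` (\<Inter>X\<in>?F. X)"
    by (rule image_INT[of \<tau> UNIV, symmetric]) (use S permutes_inj[OF assms(2)] in auto)
  finally have "\<sigma> ` \<Inter>?F = \<tau> ` \<Inter>?F" by simp
  then show ?thesis using S unfolding cluster_def balanced_def by blast
qed

lemma cluster_subset_carrier:
  assumes "\<sigma> permutes S" "\<tau> permutes S" "p \<in> S"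
  shows "cluster S \<sigma> \<tau> p \<subseteq> S"
  using balanced_cluster[OF assms] by (simp add: balanced_def)

text \<open>Both maps have the same image on \<open>X\<close>, so the two pieces fill complementary
  sets of columns. The spliced map is then onto the finite set \<open>S\<close>, hence
  bijective.\<close>

lemma permutes_switch:
  assumes "finite S" "\<sigma> permutes S" "\<tau> permutes S" "balanced S \<sigma> \<tau> X"
  shows "switch X \<sigma> \<tau> permutes S"
proof (rule bij_imp_permutes)
  have X: "X \<subseteq> S" "\<sigma> ` X = \<tau> ` X" using assms by (auto simp: balanced_def)
  have "switch X \<sigma> \<tau> ` S = \<tau> ` X \<union> \<sigma> ` (S - X)"
    using X(1) by (auto simp: switch_def)
  also have "\<dots> = \<sigma> ` S" using X by blast
  finally have img: "switch X \<sigma> \<tau> ` S = S" using permutes_image[OF assms(2)] by simp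
  then show "bij_betw (switch X \<sigma> \<tau>) S S"
    by (simp add: bij_betw_def eq_card_imp_inj_on assms(1))
  show "switch X \<sigma> \<tau> i = i" if "i \<notin> S" for i
    using that X(1) permutes_not_in[OF assms(2)] by (auto simp: switch_def)
qed

lemma switch_image:
  assumes "\<sigma> permutes S" "\<tau> permutes S" "balanced S \<sigma> \<tau> X" "balanced S \<sigma> \<tau> Y"
  shows "switch X \<sigma> \<tau> ` Y = \<sigma> ` Y"
proof -
  have "switch X \<sigma> \<tau> ` Y = \<tau> ` (Y \<inter> X) \<union> \<sigma> ` (Y - X)"
    by (auto simp: switch_def)
  also have "\<tau> ` (Y \<inter> X) = \<sigma> ` (Y \<inter> X)"
    using balanced_Int[OF assms(1,2,4,3)] by (simp add: balanced_def)
  finally show ?thesis by blast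
qed

lemma balanced_commute: "balanced S \<sigma> \<tau> X = balanced S \<tau> \<sigma> X"
  by (auto simp: balanced_def)

lemma switch_switch: "switch X (switch X \<sigma> \<tau>) (switch X \<tau> \<sigma>) = \<sigma>"
  by (auto simp: switch_def)

text \<open>Switching preserves the image of every balanced set, so none is lost; none is gained
  because switching twice restores the pair. Clusters are therefore unchanged, which makes switching
  on the cluster of \<open>p\<close> an involution.\<close>

lemma balanced_switch:
  assumes "finite S" "\<sigma> permutes S" "\<tau> permutes S" "balanced S \<sigma> \<tau> X"
  shows "balanced S (switch X \<sigma> \<tau>) (switch X \<tau> \<sigma>) Y = balanced S \<sigma> \<tau> Y"
proof -
  have *: "balanced S (switch X \<sigma> \<tau>) (switch X \<tau> \<sigma>) Y"
    if "\<sigma> permutes S" "\<tau> permutes S" "balanced S \<sigma> \<tau> X" "balanced S \<sigma> \<tau> Y" for \<sigma> \<tau> Y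
    using switch_image[OF that] switch_image[OF that(2,1), of X Y] that
    by (simp add: balanced_def)
  show ?thesis
  proof
    assume Y: "balanced S (switch X \<sigma> \<tau>) (switch X \<tau> \<sigma>) Y"
    have p: "switch X \<sigma> \<tau> permutes S" "switch X \<tau> \<sigma> permutes S"
      using permutes_switch assms balanced_commute by metis+
    show "balanced S \<sigma> \<tau> Y"
      using *[OF p *[OF assms(2-4,4)] Y] by (simp add: switch_switch)
  qed (use * assms in blast)
qed

lemma cluster_switch:
  assumes "finite S" "\<sigma> permutes S" "\<tau> permutes S" "balanced S \<sigma> \<tau> X"
  shows "cluster S (switch X \<sigma> \<tau>) (switch X \<tau> \<sigma>) p = cluster S \<sigma> \<tau> p"
  by (simp add: cluster_def balanced_switch[OF assms])

text \<open>The set cut off in the proof is the part of the cycle of \<open>inv \<tau> \<circ> \<sigma>\<close> from \<open>p\<close> up to \<open>q\<close>.\<close>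

lemma cluster_transpose:
  assumes fin: "finite S" and \<sigma>: "\<sigma> permutes S" and \<tau>: "\<tau> permutes S"
    and S: "p \<in> S" "q \<in> S" and q: "q \<in> cluster S \<sigma> \<tau> p" and neq: "p \<noteq> q"
  shows "q \<notin> cluster S \<sigma> (\<tau> \<circ> Transposition.transpose p q) p"
proof -
  define \<pi> where "\<pi> = inv \<tau> \<circ> \<sigma>"
  have \<pi>: "\<pi> permutes S"
    unfolding \<pi>_def by (rule permutes_compose[OF \<sigma> permutes_inv[OF \<tau>]])
  have \<tau>\<pi>: "\<tau> (\<pi> i) = \<sigma> i" for i
    by (simp add: \<pi>_def permutes_inverses(1)[OF \<tau>])
  have inS: "(\<pi> ^^ n) p \<in> S" for n
    by (induction n) (simp_all add: S permutes_in_image[OF \<pi>])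
  \<comment> \<open>By finiteness the forward orbit of \<open>p\<close> is mapped onto itself, hence
    is balanced and contains the cluster. So \<open>q\<close> is reached by iterating
    \<open>\<pi>\<close>.\<close>
  define Q where "Q = range (\<lambda>n. (\<pi> ^^ n) p)"
  have Q: "Q \<subseteq> S" using inS by (auto simp: Q_def)
  have "\<pi> ` Q \<subseteq> Q"
  proof
    fix x assume "x \<in> \<pi> ` Q"
    then obtain n where "x = (\<pi> ^^ Suc n) p" unfolding Q_def by auto
    then show "x \<in> Q" unfolding Q_def by blast
  qed
  moreover have "card (\<pi> ` Q) = card Q"
    by (intro card_image inj_on_subset[OF permutes_inj[OF \<pi>]]) auto
  ultimately have "\<pi> ` Q = Q"
    by (intro card_subset_eq finite_subset[OF Q fin])
  then have "\<tau> ` \<pi> ` Q = \<tau> ` Q" by simp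
  then have "\<sigma> ` Q = \<tau> ` Q"
    by (simp only: image_image \<tau>\<pi>)
  then have "balanced S \<sigma> \<tau> Q" using Q by (simp add: balanced_def)
  moreover have "p \<in> Q"
    unfolding Q_def by (rule range_eqI[of _ _ 0]) simp
  ultimately have "cluster S \<sigma> \<tau> p \<subseteq> Q" by (rule cluster_subset)
  then have "q \<in> Q" using q by blast
  then have ex: "\<exists>n. (\<pi> ^^ n) p = q" unfolding Q_def by blast
  \<comment> \<open>At the first visit to \<open>q\<close>, minimality also excludes an earlier
    return to \<open>p\<close>: such a return would give an earlier visit.\<close>
  define n where "n = (LEAST n. (\<pi> ^^ n) p = q)"
  have n: "(\<pi> ^^ n) p = q" unfolding n_def using ex by (rule LeastI_ex)
  have min: "(\<pi> ^^ k) p \<noteq> q" if "k < n" for k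
    using that not_less_Least unfolding n_def by blast
  have "n > 0" using n neq by (cases n) auto
  have nop: "(\<pi> ^^ k) p \<noteq> p" if "0 < k" "k < n" for k
  proof
    assume *: "(\<pi> ^^ k) p = p"
    have "(\<pi> ^^ (n - k + k)) p = (\<pi> ^^ (n - k)) ((\<pi> ^^ k) p)"
      unfolding funpow_add by (rule comp_apply)
    then have "(\<pi> ^^ n) p = (\<pi> ^^ (n - k)) ((\<pi> ^^ k) p)"
      using that by (simp only: le_add_diff_inverse2 less_imp_le)
    then show False using * n min[of "n - k"] that by simp
  qed
  define X where "X = (\<lambda>k. (\<pi> ^^ k) p) ` {..<n}"
  have pX: "p \<in> X" unfolding X_def
    by (rule image_eqI[of _ _ 0]) (use \<open>n > 0\<close> in auto)
  have qX: "q \<notin> X" using min by (auto simp: X_def)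
  \<comment> \<open>Applying \<open>\<pi>\<close> advances the segment by one step: it loses
    \<open>p\<close> and gains \<open>q\<close>, exactly as under the transposition.\<close>
  have "\<pi> ` X = (\<lambda>k. (\<pi> ^^ k) p) ` Suc ` {..<n}"
    by (simp add: X_def image_image)
  also have "Suc ` {..<n} = insert n ({..<n} - {0})"
    unfolding image_Suc_lessThan using \<open>n > 0\<close> by auto
  also have "(\<lambda>k. (\<pi> ^^ k) p) ` insert n ({..<n} - {0}) = insert q (X - {p})"
  proof -
    have "{..<n} = insert 0 ({..<n} - {0})" using \<open>n > 0\<close> by blast
    then have "X = insert p ((\<lambda>k. (\<pi> ^^ k) p) ` ({..<n} - {0}))"
      unfolding X_def by (metis (no_types, lifting) funpow_0 image_insert)
    moreover have "p \<notin> (\<lambda>k. (\<pi> ^^ k) p) ` ({..<n} - {0})"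
      using nop by force
    ultimately show ?thesis using n by simp
  qed
  also have "\<dots> = Transposition.transpose p q ` X"
  proof -
    have "Transposition.transpose p q ` (X - {p}) = (\<lambda>i. i) ` (X - {p})"
      by (rule image_cong) (use qX in \<open>auto simp: Transposition.transpose_def\<close>)
    moreover have "X = insert p (X - {p})" using pX by blast
    ultimately show ?thesis
      by (metis image_ident image_insert transpose_apply_first)
  qed
  finally have "\<tau> ` \<pi> ` X = \<tau> ` Transposition.transpose p q ` X" by simp
  then have "\<sigma> ` X = (\<tau> \<circ> Transposition.transpose p q) ` X"
    by (simp only: image_image \<tau>\<pi> comp_def)
  then have "balanced S \<sigma> (\<tau> \<circ> Transposition.transpose p q) X"
    using inS by (auto simp: balanced_def X_def)
  then have "cluster S \<sigma> (\<tau> \<circ> Transposition.transpose p q) p \<subseteq> X"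
    using pX by (rule cluster_subset)
  then show ?thesis using qX by blast
qed

section \<open>Inequalities for duplicated rows\<close>

lemma perm_weight_nonneg: "(\<And>i j. A i j \<ge> 0) \<Longrightarrow> perm_weight S A \<sigma> \<ge> 0"
  by (simp add: perm_weight_def prod_nonneg)

lemma permanent_nonneg: "(\<And>i j. A i j \<ge> 0) \<Longrightarrow> permanent S A \<ge> 0"
  by (simp add: permanent_def sum_nonneg perm_weight_nonneg)

lemma permutes_comp_transpose:
  "\<tau> permutes S \<Longrightarrow> p \<in> S \<Longrightarrow> q \<in> S \<Longrightarrow> \<tau> \<circ> Transposition.transpose p q permutes S"
  by (intro permutes_compose permutes_swap_id)

lemma perm_weight_comp_transpose:
  assumes "p \<in> S" "q \<in> S"
  shows "perm_weight S A (\<tau> \<circ> Transposition.transpose p q) = perm_weight S (A \<circ> Transposition.transpose p q) \<tau>"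
proof -
  have "perm_weight S A (\<tau> \<circ> Transposition.transpose p q) 
      = (\<Prod>i\<in>S. A (Transposition.transpose p q (Transposition.transpose p q i)) (\<tau> (Transposition.transpose p q i)))"
    by (simp add: perm_weight_def)
  also have "\<dots> = (\<Prod>i\<in>S. A (Transposition.transpose p q i) (\<tau> i))"
    using prod.permute[OF permutes_swap_id[OF assms], of "\<lambda>i. A (Transposition.transpose p q i) (\<tau> i)"]
    by (simp add: comp_def)
  finally show ?thesis by (simp add: perm_weight_def)
qed

text \<open>
  Swapping \<open>\<sigma>\<close> and \<open>\<tau>\<close> on the cycle of \<open>p\<close>, which misses \<open>q\<close>, moves one of the two copies of each
  duplicated row to the other permutation.
\<close>

lemma sum_switch:
  assumes fin: "finite S" and S: "p \<in> S" "q \<in> S"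
  defines "D \<equiv> {(\<sigma>, \<tau>). \<sigma> permutes S \<and> \<tau> permutes S \<and> q \<notin> cluster S \<sigma> \<tau> p}"
  shows "(\<Sum>(\<sigma>, \<tau>)\<in>D. perm_weight S (A(p := A q)) \<sigma> * perm_weight S (A(q := A p)) \<tau>) =
         (\<Sum>(\<sigma>, \<tau>)\<in>D. perm_weight S A \<sigma> * perm_weight S A (\<tau> \<circ> Transposition.transpose p q))"
proof -
  define T where "T = (\<lambda>(\<sigma>, \<tau>). let c = cluster S \<sigma> \<tau> p in (switch c \<sigma> \<tau>, switch c \<tau> \<sigma>))"
  have TD: "T x \<in> D" and TT: "T (T x) = x"
    and wt: "(case T x of (\<sigma>, \<tau>) \<Rightarrow> perm_weight S A \<sigma> * perm_weight S A (\<tau> \<circ> Transposition.transpose p q))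
       = (case x of (\<sigma>, \<tau>) \<Rightarrow> perm_weight S (A(p := A q)) \<sigma> * perm_weight S (A(q := A p)) \<tau>)"
    if xD: "x \<in> D" for x
  proof -
    obtain \<sigma> \<tau> where x: "x = (\<sigma>, \<tau>)" by (cases x)
    then have p: "\<sigma> permutes S" "\<tau> permutes S" and q: "q \<notin> cluster S \<sigma> \<tau> p"
      using xD by (auto simp: D_def)
    define c where "c = cluster S \<sigma> \<tau> p"
    have b: "balanced S \<sigma> \<tau> c" unfolding c_def by (rule balanced_cluster[OF p S(1)])
    have b': "balanced S \<tau> \<sigma> c" using b balanced_commute by metis
    have c: "p \<in> c" "q \<notin> c" using q by (auto simp: c_def self_in_cluster)
    have Tx: "T x = (switch c \<sigma> \<tau>, switch c \<tau> \<sigma>)" by (simp add: x T_def Let_def c_def)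
    have cl: "cluster S (switch c \<sigma> \<tau>) (switch c \<tau> \<sigma>) p = c"
      using cluster_switch[OF fin p b] c_def by simp
    show "T x \<in> D" unfolding Tx
      using permutes_switch[OF fin p b] permutes_switch[OF fin p(2,1) b'] cl c
      by (simp add: D_def)
    show "T (T x) = x"
      unfolding Tx by (simp add: T_def cl switch_switch x)
    have "perm_weight S A (switch c \<sigma> \<tau>) * perm_weight S (A \<circ> Transposition.transpose p q) (switch c \<tau> \<sigma>)
        = perm_weight S (A(p := A q)) \<sigma> * perm_weight S (A(q := A p)) \<tau>"
      unfolding perm_weight_def prod.distrib[symmetric]
      by (rule prod.cong) (use c in \<open>auto simp: switch_def Transposition.transpose_def\<close>)
    then show "(case T x of (\<sigma>, \<tau>) \<Rightarrow> perm_weight S A \<sigma> * perm_weight S A (\<tau> \<circ> Transposition.transpose p q))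
       = (case x of (\<sigma>, \<tau>) \<Rightarrow> perm_weight S (A(p := A q)) \<sigma> * perm_weight S (A(q := A p)) \<tau>)"
      unfolding Tx unfolding x by (simp add: perm_weight_comp_transpose[OF S])
  qed
  show ?thesis
    by (rule sum.reindex_bij_witness[of D T T]) (use TD TT wt in auto)
qed

text \<open>By \<open>cluster_transpose\<close>, composing \<open>\<tau>\<close> with the
  transposition cuts the common cycle. This is an involution on all pairs, so it injects the
  connected pairs into the separated ones.\<close>

lemma sum_split_le:
  fixes f :: "('a \<Rightarrow> 'a) \<Rightarrow> ('a \<Rightarrow> 'a) \<Rightarrow> real"
  assumes fin: "finite S" and S: "p \<in> S" "q \<in> S" "p \<noteq> q" and f: "\<And>\<sigma> \<tau>. f \<sigma> \<tau> \<ge> 0"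
  shows "(\<Sum>(\<sigma>, \<tau>) | \<sigma> permutes S \<and> \<tau> permutes S \<and> q \<in> cluster S \<sigma> \<tau> p.
            f \<sigma> (\<tau> \<circ> Transposition.transpose p q))
       \<le> (\<Sum>(\<sigma>, \<tau>) | \<sigma> permutes S \<and> \<tau> permutes S \<and> q \<notin> cluster S \<sigma> \<tau> p. f \<sigma> \<tau>)"
    (is "sum ?g ?N \<le> sum ?h ?D")
proof -
  define t where "t = Transposition.transpose p q"
  define T where "T = (\<lambda>(\<sigma>::'a \<Rightarrow> 'a, \<tau>::'a \<Rightarrow> 'a). (\<sigma>, \<tau> \<circ> t))"
  have tt: "\<tau> \<circ> t \<circ> t = \<tau>" for \<tau> :: "'a \<Rightarrow> 'a"
    by (auto simp: t_def fun_eq_iff)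
  have "inj T"
    by (rule inj_on_inverseI[of _ T]) (auto simp: T_def tt)
  then have inj: "inj_on T ?N" by (rule inj_on_subset) simp
  have sub: "T ` ?N \<subseteq> ?D"
    using cluster_transpose[OF fin _ _ S(1,2) _ S(3)] permutes_comp_transpose[OF _ S(1,2)]
    by (auto simp: T_def t_def)
  have "finite ?D"
    by (rule finite_subset[of _ "{\<sigma>. \<sigma> permutes S} \<times> {\<sigma>. \<sigma> permutes S}"])
       (use finite_permutations[OF fin] in auto)
  then have "sum ?h (T ` ?N) \<le> sum ?h ?D"
    by (rule sum_mono2[OF _ sub]) (use f in auto)
  moreover have "sum ?h (T ` ?N) = sum ?g ?N"
    by (subst sum.reindex[OF inj]) (auto simp: T_def t_def intro!: sum.cong)
  ultimately show ?thesis by simp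
qed

lemma permanent_times:
  assumes "finite S"
  shows "permanent S A * permanent S B =
    (\<Sum>(\<sigma>, \<tau>) | \<sigma> permutes S \<and> \<tau> permutes S. perm_weight S A \<sigma> * perm_weight S B \<tau>)"
  by (auto simp: permanent_def sum_product sum.cartesian_product intro!: sum.cong)

lemma permanent_duplicate_rows:
  assumes fin: "finite S" and S: "p \<in> S" "q \<in> S" "p \<noteq> q" and A: "\<And>i j. A i j \<ge> 0"
  shows permanent_duplicate_rows_le:
      "permanent S (A(p := A q)) * permanent S (A(q := A p)) \<le> 2 * (permanent S A)\<^sup>2" (is ?le)
    and same_cluster_le_permanent_duplicate_rows:
      "(\<Sum>(\<sigma>, \<tau>) | \<sigma> permutes S \<and> \<tau> permutes S \<and> q \<in> cluster S \<sigma> \<tau> p.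
          perm_weight S A \<sigma> * perm_weight S A \<tau>)
        \<le> permanent S (A(p := A q)) * permanent S (A(q := A p))" (is ?ge)
proof -
  define t where "t = Transposition.transpose p q"
  let ?P = "{(\<sigma>, \<tau>). \<sigma> permutes S \<and> \<tau> permutes S}"
  let ?N = "{(\<sigma>, \<tau>). \<sigma> permutes S \<and> \<tau> permutes S \<and> q \<in> cluster S \<sigma> \<tau> p}"
  let ?D = "{(\<sigma>, \<tau>). \<sigma> permutes S \<and> \<tau> permutes S \<and> q \<notin> cluster S \<sigma> \<tau> p}"
  let ?B = "A(p := A q)" and ?B' = "A(q := A p)"
  let ?w = "perm_weight S"
  have w: "?w A \<sigma> \<ge> 0" "?w ?B \<sigma> \<ge> 0" "?w ?B' \<sigma> \<ge> 0" for \<sigma>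
    by (auto intro!: perm_weight_nonneg A)
  have tt: "\<tau> \<circ> t \<circ> t = \<tau>" for \<tau> :: "'a \<Rightarrow> 'a"
    by (auto simp: t_def fun_eq_iff)
  have finP: "finite ?P"
    by (rule finite_subset[of _ "{\<sigma>. \<sigma> permutes S} \<times> {\<sigma>. \<sigma> permutes S}"])
       (use finite_permutations[OF fin] in auto)
  have finN: "finite ?N" and finD: "finite ?D"
    by (rule finite_subset[OF _ finP], blast)+
  have split: "sum g ?P = sum g ?N + sum g ?D" for g :: "('a \<Rightarrow> 'a) \<times> ('a \<Rightarrow> 'a) \<Rightarrow> real"
    by (subst sum.union_disjoint[symmetric]) (auto intro!: sum.cong finN finD)
  \<comment> \<open>Rows \<open>p\<close> and \<open>q\<close> of \<open>?B'\<close> coincide, so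
    splitting preserves the weight under \<open>?B'\<close>. The connected part of the product is
    thus at most its separated part, whence the factor 2.\<close>
  have "?B' \<circ> t = ?B'" by (auto simp: t_def Transposition.transpose_def fun_eq_iff)
  then have B't: "?w ?B' (\<tau> \<circ> t) = ?w ?B' \<tau>" for \<tau>
    using perm_weight_comp_transpose[OF S(1,2), of ?B' \<tau>] by (simp add: t_def)
  have switch: "(\<Sum>(\<sigma>, \<tau>)\<in>?D. ?w ?B \<sigma> * ?w ?B' \<tau>) = (\<Sum>(\<sigma>, \<tau>)\<in>?D. ?w A \<sigma> * ?w A (\<tau> \<circ> t))"
    unfolding t_def by (rule sum_switch[OF fin S(1,2)])
  have prod: "permanent S ?B * permanent S ?B' = (\<Sum>(\<sigma>, \<tau>)\<in>?P. ?w ?B \<sigma> * ?w ?B' \<tau>)"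
    by (rule permanent_times[OF fin])
  have "(\<Sum>(\<sigma>, \<tau>)\<in>?N. ?w ?B \<sigma> * ?w ?B' \<tau>) \<le> (\<Sum>(\<sigma>, \<tau>)\<in>?D. ?w ?B \<sigma> * ?w ?B' \<tau>)"
    using sum_split_le[OF fin S, of "\<lambda>\<sigma> \<tau>. ?w ?B \<sigma> * ?w ?B' \<tau>"] w
    by (simp add: B't[unfolded t_def])
  moreover have "(\<Sum>(\<sigma>, \<tau>)\<in>?D. ?w A \<sigma> * ?w A (\<tau> \<circ> t)) \<le> (\<Sum>(\<sigma>, \<tau>)\<in>?P. ?w A \<sigma> * ?w A (\<tau> \<circ> t))"
    by (rule sum_mono2[OF finP]) (use w in auto)
  moreover have "(\<Sum>(\<sigma>, \<tau>)\<in>?P. ?w A \<sigma> * ?w A (\<tau> \<circ> t)) = (\<Sum>(\<sigma>, \<tau>)\<in>?P. ?w A \<sigma> * ?w A \<tau>)"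
    by (rule sum.reindex_bij_witness[of _ "\<lambda>(\<sigma>, \<tau>). (\<sigma>, \<tau> \<circ> t)" "\<lambda>(\<sigma>, \<tau>). (\<sigma>, \<tau> \<circ> t)"])
       (use permutes_comp_transpose[OF _ S(1,2)] tt in \<open>auto simp: t_def\<close>)
  ultimately show ?le
    using switch prod split[of "\<lambda>(\<sigma>, \<tau>). ?w ?B \<sigma> * ?w ?B' \<tau>"]
    unfolding power2_eq_square permanent_times[OF fin] by linarith
  \<comment> \<open>Here splitting is applied to a weight that already contains \<open>t\<close>;
    the two transpositions cancel on the connected side.\<close>
  have "(\<Sum>(\<sigma>, \<tau>)\<in>?N. ?w A \<sigma> * ?w A \<tau>) \<le> (\<Sum>(\<sigma>, \<tau>)\<in>?D. ?w A \<sigma> * ?w A (\<tau> \<circ> t))"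
    using sum_split_le[OF fin S, of "\<lambda>\<sigma> \<tau>. ?w A \<sigma> * ?w A (\<tau> \<circ> t)"] w
    by (simp add: tt[unfolded t_def] t_def)
  moreover have "0 \<le> (\<Sum>(\<sigma>, \<tau>)\<in>?N. ?w ?B \<sigma> * ?w ?B' \<tau>)"
    by (rule sum_nonneg) (use w in auto)
  ultimately show ?ge
    using switch prod split[of "\<lambda>(\<sigma>, \<tau>). ?w ?B \<sigma> * ?w ?B' \<tau>"] by linarith
qed

section \<open>Expansion along a row and sums of local functions\<close>

lemma permanent_replace_row:
  assumes fin: "finite S" and i: "i \<in> S"
  shows "permanent S (A(i := A k)) = (\<Sum>j\<in>S. A k j * permanent_minor S A i j)"
proof -
  have "permanent S (A(i := A k)) = (\<Sum>\<sigma> | \<sigma> permutes S. A k (\<sigma> i) * perm_weight (S - {i}) A \<sigma>)"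
    unfolding permanent_def
  proof (rule sum.cong)
    fix \<sigma> assume "\<sigma> \<in> {\<sigma>. \<sigma> permutes S}"
    have "perm_weight (S - {i}) (A(i := A k)) \<sigma> = perm_weight (S - {i}) A \<sigma>"
      unfolding perm_weight_def by (rule prod.cong) auto
    then show "perm_weight S (A(i := A k)) \<sigma> = A k (\<sigma> i) * perm_weight (S - {i}) A \<sigma>"
      using prod.remove[OF fin i, of "\<lambda>j. (A(i := A k)) j (\<sigma> j)"]
      by (simp add: perm_weight_def)
  qed simp
  also have "\<dots> = (\<Sum>j\<in>S. \<Sum>\<sigma> | \<sigma> \<in> {\<sigma>. \<sigma> permutes S} \<and> \<sigma> i = j.
                  A k (\<sigma> i) * perm_weight (S - {i}) A \<sigma>)"
    by (rule sum.group[symmetric]) (use finite_permutations[OF fin] fin i in \<open>auto simp: permutes_in_image\<close>)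
  also have "\<dots> = (\<Sum>j\<in>S. A k j * permanent_minor S A i j)"
    by (auto simp: permanent_minor_def sum_distrib_left intro!: sum.cong)
  finally show ?thesis .
qed

lemma permanent_minor_nonneg: "(\<And>i j. A i j \<ge> 0) \<Longrightarrow> permanent_minor S A i j \<ge> 0"
  by (simp add: permanent_minor_def sum_nonneg perm_weight_nonneg)

text \<open>\<open>A i j * permanent_minor S A i j\<close> is the total weight of the permutations
  using the entry at \<open>i\<close>, \<open>j\<close>; the rest is linearity of
  expectation.\<close>

lemma sum_perm_weight_local:
  assumes fin: "finite S"
  shows "(\<Sum>\<sigma> | \<sigma> permutes S. perm_weight S A \<sigma> * (\<Sum>i\<in>S. f i (\<sigma> i)))
       = (\<Sum>i\<in>S. \<Sum>j\<in>S. f i j * A i j * permanent_minor S A i j)"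
proof -
  have "(\<Sum>\<sigma> | \<sigma> permutes S. perm_weight S A \<sigma> * (\<Sum>i\<in>S. f i (\<sigma> i)))
      = (\<Sum>i\<in>S. \<Sum>\<sigma> | \<sigma> permutes S. perm_weight S A \<sigma> * f i (\<sigma> i))"
    by (simp add: sum_distrib_left sum.swap[of _ S])
  also have "\<dots> = (\<Sum>i\<in>S. \<Sum>j\<in>S. f i j * A i j * permanent_minor S A i j)"
  proof (rule sum.cong)
    fix i assume i: "i \<in> S"
    have "(\<Sum>\<sigma> | \<sigma> permutes S. perm_weight S A \<sigma> * f i (\<sigma> i))
      = (\<Sum>\<sigma> | \<sigma> permutes S. f i (\<sigma> i) * A i (\<sigma> i) * perm_weight (S - {i}) A \<sigma>)"
      by (simp add: perm_weight_def prod.remove[OF fin i] mult_ac)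
    also have "\<dots> = (\<Sum>j\<in>S. \<Sum>\<sigma> | \<sigma> \<in> {\<sigma>. \<sigma> permutes S} \<and> \<sigma> i = j.
          f i (\<sigma> i) * A i (\<sigma> i) * perm_weight (S - {i}) A \<sigma>)"
      by (rule sum.group[symmetric]) (use finite_permutations[OF fin] fin i in \<open>auto simp: permutes_in_image\<close>)
    also have "\<dots> = (\<Sum>j\<in>S. f i j * A i j * permanent_minor S A i j)"
      by (auto simp: permanent_minor_def sum_distrib_left mult_ac intro!: sum.cong)
    finally show "(\<Sum>\<sigma> | \<sigma> permutes S. perm_weight S A \<sigma> * f i (\<sigma> i))
      = (\<Sum>j\<in>S. f i j * A i j * permanent_minor S A i j)" .
  qed simp
  finally show ?thesis .
qed

text \<open>Rows and columns get separate relabellings, because a reflection of the torus acts by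
  different formulas on even and odd sites.\<close>

lemma sum_permutes_conj:
  fixes f :: "('a \<Rightarrow> 'a) \<Rightarrow> real" and \<rho> \<kappa> :: "'a \<Rightarrow> 'a"
  assumes "\<rho> permutes S" "\<kappa> permutes S"
  shows "(\<Sum>\<sigma> | \<sigma> permutes S. f (\<kappa> \<circ> \<sigma> \<circ> inv \<rho>)) = (\<Sum>\<sigma> | \<sigma> permutes S. f \<sigma>)"
proof (rule sum.reindex_bij_witness[of _ "\<lambda>\<sigma>. inv \<kappa> \<circ> \<sigma> \<circ> \<rho>" "\<lambda>\<sigma>. \<kappa> \<circ> \<sigma> \<circ> inv \<rho>"])
  fix \<sigma> assume "\<sigma> \<in> {\<sigma>. \<sigma> permutes S}"
  then have \<sigma>: "\<sigma> permutes S" by simp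
  show "\<kappa> \<circ> (inv \<kappa> \<circ> \<sigma> \<circ> \<rho>) \<circ> inv \<rho> = \<sigma>" "inv \<kappa> \<circ> (\<kappa> \<circ> \<sigma> \<circ> inv \<rho>) \<circ> \<rho> = \<sigma>"
    by (simp_all add: fun_eq_iff permutes_inverses[OF assms(1)] permutes_inverses[OF assms(2)])
  show "inv \<kappa> \<circ> \<sigma> \<circ> \<rho> \<in> {\<sigma>. \<sigma> permutes S}" "\<kappa> \<circ> \<sigma> \<circ> inv \<rho> \<in> {\<sigma>. \<sigma> permutes S}"
    using permutes_compose[OF assms(1) permutes_compose[OF \<sigma> permutes_inv[OF assms(2)]]]
      permutes_compose[OF permutes_inv[OF assms(1)] permutes_compose[OF \<sigma> assms(2)]]
    by (simp_all only: mem_Collect_eq comp_assoc)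
qed simp

lemma perm_weight_conj:
  assumes "\<rho> permutes S"
  shows "perm_weight S A (\<kappa> \<circ> \<sigma> \<circ> inv \<rho>) = perm_weight S (\<lambda>i j. A (\<rho> i) (\<kappa> j)) \<sigma>"
  using prod.permute[OF assms, of "\<lambda>i. A i (\<kappa> (\<sigma> (inv \<rho> i)))"]
  by (simp add: perm_weight_def comp_def permutes_inverses[OF assms])

lemma perm_weight_cong:
  assumes "\<sigma> permutes S" "\<And>i j. i \<in> S \<Longrightarrow> j \<in> S \<Longrightarrow> A i j = B i j"
  shows "perm_weight S A \<sigma> = perm_weight S B \<sigma>"
  using assms by (auto simp: perm_weight_def permutes_in_image intro!: prod.cong)

lemma permanent_relabel:
  assumes "\<rho> permutes S" "\<kappa> permutes S"
    and "\<And>i j. i \<in> S \<Longrightarrow> j \<in> S \<Longrightarrow> A (\<rho> i) (\<kappa> j) = B i j"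
  shows "permanent S A = permanent S B"
proof -
  have "permanent S A = (\<Sum>\<sigma> | \<sigma> permutes S. perm_weight S A (\<kappa> \<circ> \<sigma> \<circ> inv \<rho>))"
    unfolding permanent_def by (rule sum_permutes_conj[OF assms(1,2), symmetric])
  also have "\<dots> = permanent S B"
    unfolding permanent_def perm_weight_conj[OF assms(1)]
    by (intro sum.cong refl perm_weight_cong assms(3)) auto
  finally show ?thesis .
qed

text \<open>Pulled back along \<open>\<rho>\<close>, the relabelled cluster is a balanced set
  containing \<open>i\<close>, so it contains the cluster of \<open>i\<close>.\<close>

lemma card_cluster_conj:
  assumes fin: "finite S" and \<rho>: "\<rho> permutes S" and \<kappa>: "\<kappa> permutes S"
    and \<sigma>: "\<sigma> permutes S" and \<tau>: "\<tau> permutes S" and i: "i \<in> S"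
  shows "card (cluster S \<sigma> \<tau> i) \<le> card (cluster S (\<kappa> \<circ> \<sigma> \<circ> inv \<rho>) (\<kappa> \<circ> \<tau> \<circ> inv \<rho>) (\<rho> i))"
proof -
  define c where "c = cluster S (\<kappa> \<circ> \<sigma> \<circ> inv \<rho>) (\<kappa> \<circ> \<tau> \<circ> inv \<rho>) (\<rho> i)"
  have \<rho>i: "\<rho> i \<in> S" using i permutes_in_image[OF \<rho>] by simp
  have "balanced S (\<kappa> \<circ> \<sigma> \<circ> inv \<rho>) (\<kappa> \<circ> \<tau> \<circ> inv \<rho>) c"
    unfolding c_def
    by (rule balanced_cluster[OF permutes_compose[OF permutes_inv[OF \<rho>] permutes_compose[OF \<sigma> \<kappa>]]
          permutes_compose[OF permutes_inv[OF \<rho>] permutes_compose[OF \<tau> \<kappa>]] \<rho>i])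
  then have c: "c \<subseteq> S" "\<kappa> ` \<sigma> ` inv \<rho> ` c = \<kappa> ` \<tau> ` inv \<rho> ` c"
    by (simp_all only: balanced_def image_comp comp_assoc)
  have "\<sigma> ` inv \<rho> ` c = \<tau> ` inv \<rho> ` c"
    using c(2) by (simp only: inj_image_eq_iff[OF permutes_inj[OF \<kappa>]])
  moreover have "inv \<rho> ` c \<subseteq> S"
    using c(1) by (auto simp: permutes_in_image[OF permutes_inv[OF \<rho>]])
  ultimately have "balanced S \<sigma> \<tau> (inv \<rho> ` c)" by (simp add: balanced_def)
  moreover have "i \<in> inv \<rho> ` c"
    unfolding c_def
    by (rule image_eqI[of _ _ "\<rho> i"]) (simp_all add: self_in_cluster permutes_inverses(2)[OF \<rho>])
  ultimately have "cluster S \<sigma> \<tau> i \<subseteq> inv \<rho> ` c" by (rule cluster_subset)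
  moreover have "finite c" using c(1) fin finite_subset by blast
  ultimately have "card (cluster S \<sigma> \<tau> i) \<le> card (inv \<rho> ` c)"
    by (intro card_mono) auto
  also have "\<dots> \<le> card c" using \<open>finite c\<close> by (rule card_image_le)
  finally show ?thesis by (simp add: c_def)
qed

subsection \<open>Circulant permanents\<close>

text \<open>
  Row \<open>i\<close> stands for the even site \<open>2 i\<close> and column \<open>j\<close> for the odd site \<open>2 j + 1\<close> of a torus of
  length \<open>2 N\<close>; the entry depends on \<open>j - i\<close> only, and \<open>u \<mapsto> - 1 - u\<close> reverses the displacement
  \<open>2 u + 1\<close>.
\<close>

locale circulant =
  fixes N :: nat and a :: "int \<Rightarrow> real"
  assumes N_pos: "N > 0"
    and periodic: "a (u mod int N) = a u"
    and reflection: "a (- 1 - u) = a u"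
    and nonneg: "a u \<ge> 0"
    and row_sum: "(\<Sum>u\<in>{0..<int N}. a u) = 1"
begin

definition S :: "int set" where "S = {0..<int N}"

definition A :: "int \<Rightarrow> int \<Rightarrow> real" where "A i j = a (j - i)"

lemma finite_S [simp]: "finite S" and card_S [simp]: "card S = N"
  by (simp_all add: S_def)

lemma mod_in_S [simp]: "u mod int N \<in> S"
  using N_pos by (simp add: S_def)

lemma mod_S [simp]: "u \<in> S \<Longrightarrow> u mod int N = u"
  by (simp add: S_def)

lemma zero_in_S [simp]: "0 \<in> S"
  using N_pos by (simp add: S_def)

lemma A_nonneg: "A i j \<ge> 0"
  by (simp add: A_def nonneg)

lemma a_cong: "u mod int N = v mod int N \<Longrightarrow> a u = a v"
  by (metis periodic)

definition shift :: "int \<Rightarrow> int \<Rightarrow> int" where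
  "shift t i = (if i \<in> S then (i + t) mod int N else i)"

definition reflect :: "int \<Rightarrow> int \<Rightarrow> int" where
  "reflect t i = (if i \<in> S then (t - i) mod int N else i)"

lemma shift_permutes: "shift t permutes S"
proof (rule bij_imp_permutes)
  show "bij_betw (shift t) S S"
    by (rule bij_betw_byWitness[of _ "shift (- t)"]) (auto simp: shift_def mod_simps)
qed (simp add: shift_def)

lemma reflect_reflect: "reflect t (reflect t i) = i"
  by (simp add: reflect_def mod_simps)

lemma reflect_permutes: "reflect t permutes S"
proof (rule bij_imp_permutes)
  show "bij_betw (reflect t) S S"
    by (rule bij_betw_byWitness[of _ "reflect t"]) (auto simp: reflect_reflect, auto simp: reflect_def)
qed (simp add: reflect_def)

lemma A_shift: "i \<in> S \<Longrightarrow> j \<in> S \<Longrightarrow> A (shift t i) (shift t j) = A i j"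
  unfolding A_def by (rule a_cong) (simp add: shift_def mod_simps)

text \<open>The column offset \<open>t - 1\<close> comes from
  \<open>(t - 1 - j) - (t - i) = - 1 - (j - i)\<close>, the reversed displacement.\<close>

lemma A_reflect: "i \<in> S \<Longrightarrow> j \<in> S \<Longrightarrow> A (reflect t i) (reflect (t - 1) j) = A i j"
proof -
  assume "i \<in> S" "j \<in> S"
  then have "A (reflect t i) (reflect (t - 1) j) = a (- 1 - (j - i))"
    unfolding A_def by (intro a_cong) (simp add: reflect_def mod_diff_eq algebra_simps del: diff_diff_eq)
  then show ?thesis by (simp add: reflection A_def)
qed

section \<open>Duplicated rows of a circulant matrix\<close>

definition per :: real where "per = permanent S A"

definition rep :: "int \<Rightarrow> int \<Rightarrow> real" where "rep i k = permanent S (A(i := A k))"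

lemma per_nonneg: "per \<ge> 0"
  unfolding per_def by (rule permanent_nonneg) (rule A_nonneg)

lemma rep_nonneg: "rep i k \<ge> 0"
  unfolding rep_def by (rule permanent_nonneg) (simp add: A_nonneg)

text \<open>The reflection with parameter \<open>p + q\<close> exchanges rows \<open>p\<close> and
  \<open>q\<close> and carries one duplicated matrix to the other. Bounds on the product of the two
  permanents thereby become bounds on each.\<close>

lemma rep_commute:
  assumes "p \<in> S" "q \<in> S"
  shows "rep p q = rep q p"
  unfolding rep_def
proof (rule permanent_relabel[OF reflect_permutes[of "p + q"] reflect_permutes[of "p + q - 1"]])
  fix i j assume ij: "i \<in> S" "j \<in> S"
  let ?r = "reflect (p + q)" and ?k = "reflect (p + q - 1)"
  have r: "?r q = p" "?r p = q" using assms by (simp_all add: reflect_def)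
  have "?r i = p \<longleftrightarrow> i = q" using r reflect_reflect by metis
  moreover have "A q (?k j) = A p j"
    using A_reflect[OF assms(1) ij(2), of "p + q"] r by simp
  ultimately show "(A(p := A q)) (?r i) (?k j) = (A(q := A p)) i j"
    using A_reflect[OF ij, of "p + q"] by simp
qed

lemma rep_same: "rep p p = per"
  by (simp add: rep_def per_def)

lemma rep_le:
  assumes "p \<in> S" "q \<in> S"
  shows "rep p q \<le> sqrt 2 * per"
proof (cases "p = q")
  case True
  have "1 * per \<le> sqrt 2 * per" by (rule mult_right_mono) (auto simp: per_nonneg)
  then show ?thesis using True by (simp add: rep_same)
next
  case False
  have "(rep p q)\<^sup>2 \<le> 2 * per\<^sup>2"
    using permanent_duplicate_rows_le[OF finite_S assms False, of A] A_nonneg rep_commute[OF assms]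
    by (simp add: rep_def per_def power2_eq_square)
  also have "\<dots> = (sqrt 2 * per)\<^sup>2" by (simp add: power_mult_distrib)
  finally show ?thesis by (rule power2_le_imp_le) (simp add: per_nonneg)
qed

section \<open>Pairs of permutations and connection weights\<close>

definition wt :: "(int \<Rightarrow> int) \<Rightarrow> real" where "wt = perm_weight S A"

definition P :: "(int \<Rightarrow> int) set" where "P = {\<sigma>. \<sigma> permutes S}"

lemma finite_P [simp]: "finite P"
  by (simp add: P_def finite_permutations)

lemma wt_nonneg: "wt \<sigma> \<ge> 0"
  unfolding wt_def by (rule perm_weight_nonneg) (rule A_nonneg)

lemma per_eq: "per = (\<Sum>\<sigma>\<in>P. wt \<sigma>)"
  by (simp add: per_def P_def wt_def permanent_def)

definition wt2 :: "(int \<Rightarrow> int) \<times> (int \<Rightarrow> int) \<Rightarrow> real" where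
  "wt2 \<omega> = wt (fst \<omega>) * wt (snd \<omega>)"

definition cl :: "(int \<Rightarrow> int) \<times> (int \<Rightarrow> int) \<Rightarrow> int \<Rightarrow> int set" where
  "cl \<omega> i = cluster S (fst \<omega>) (snd \<omega>) i"

lemma wt2_nonneg: "wt2 \<omega> \<ge> 0"
  by (simp add: wt2_def wt_nonneg)

lemma per_square: "per\<^sup>2 = (\<Sum>\<omega>\<in>P \<times> P. wt2 \<omega>)"
  by (simp add: per_eq power2_eq_square sum_product sum.cartesian_product wt2_def case_prod_beta)

text \<open>The duplicated-row inequality gives the bound \<open>(rep p q)\<^sup>2\<close>, and
  trivially \<open>per\<^sup>2\<close> is a bound too. Their geometric mean is linear in
  \<open>rep p q\<close>, so it can be summed over \<open>q\<close> by the row expansion.\<close>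

lemma same_cluster_le_rep:
  assumes "p \<in> S" "q \<in> S"
  shows "(\<Sum>\<omega>\<in>P \<times> P. wt2 \<omega> * of_bool (q \<in> cl \<omega> p)) \<le> per * rep p q"
proof -
  define s where "s = (\<Sum>\<omega>\<in>P \<times> P. wt2 \<omega> * of_bool (q \<in> cl \<omega> p))"
  have "s \<le> (\<Sum>\<omega>\<in>P \<times> P. wt2 \<omega>)"
    unfolding s_def by (rule sum_mono) (simp add: wt2_nonneg)
  then have s_le: "s \<le> per\<^sup>2" by (simp add: per_square)
  show ?thesis
  proof (cases "p = q")
    case True
    then show ?thesis using s_le by (simp add: rep_same s_def power2_eq_square)
  next
    case False
    have "s \<ge> 0" unfolding s_def by (rule sum_nonneg) (simp add: wt2_nonneg)
    have "s = (\<Sum>\<omega>\<in>{\<omega> \<in> P \<times> P. q \<in> cl \<omega> p}. wt2 \<omega>)"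
      unfolding s_def by (intro sum.mono_neutral_cong_right) auto
    also have "\<dots> = (\<Sum>(\<sigma>, \<tau>) | \<sigma> permutes S \<and> \<tau> permutes S \<and> q \<in> cluster S \<sigma> \<tau> p.
          perm_weight S A \<sigma> * perm_weight S A \<tau>)"
      by (rule sum.cong) (auto simp: P_def cl_def wt2_def wt_def)
    also have "\<dots> \<le> rep p q * rep q p"
      unfolding rep_def
      by (rule same_cluster_le_permanent_duplicate_rows[OF finite_S assms False A_nonneg])
    finally have "s \<le> (rep p q)\<^sup>2" using rep_commute[OF assms] by (simp add: power2_eq_square)
    then have "s * s \<le> per\<^sup>2 * (rep p q)\<^sup>2"
      using s_le \<open>s \<ge> 0\<close> by (intro mult_mono) auto
    then have "s\<^sup>2 \<le> (per * rep p q)\<^sup>2" by (simp add: power2_eq_square mult_ac)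
    then have "s \<le> per * rep p q"
      by (rule power2_le_imp_le) (simp add: per_nonneg rep_nonneg)
    then show ?thesis by (simp add: s_def)
  qed
qed

abbreviation minor :: "int \<Rightarrow> int \<Rightarrow> real" where "minor \<equiv> permanent_minor S A"

lemma minor_nonneg: "minor i j \<ge> 0"
  by (rule permanent_minor_nonneg) (rule A_nonneg)

lemma rep_expand: "i \<in> S \<Longrightarrow> rep i k = (\<Sum>j\<in>S. A k j * minor i j)"
  unfolding rep_def by (rule permanent_replace_row[OF finite_S])

lemma minor_le:
  assumes "i \<in> S" "j \<in> S" "a u \<ge> b" "b > 0"
  shows "minor i j \<le> sqrt 2 / b * per"
proof -
  \<comment> \<open>The row from which column \<open>j\<close> is at displacement \<open>u\<close>
    modulo \<open>N\<close>; the choice does not involve \<open>i\<close>.\<close>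
  define k where "k = (j - u) mod int N"
  have "A k j = a u" unfolding A_def k_def by (rule a_cong) (simp add: mod_simps)
  then have "b * minor i j \<le> A k j * minor i j"
    using assms minor_nonneg by (simp add: mult_right_mono)
  also have "\<dots> \<le> rep i k" unfolding rep_expand[OF assms(1)]
    by (rule member_le_sum) (use assms A_nonneg minor_nonneg in auto)
  also have "\<dots> \<le> sqrt 2 * per" using rep_le[OF assms(1)] by (simp add: k_def)
  finally show ?thesis using assms(4) by (simp add: field_simps)
qed

lemma column_sum:
  assumes "j \<in> S"
  shows "(\<Sum>k\<in>S. A k j) = 1"
proof -
  have "(\<Sum>k\<in>S. A k j) = (\<Sum>k\<in>S. a (reflect j k))"
    by (rule sum.cong) (auto simp: A_def reflect_def periodic)
  also have "\<dots> = (\<Sum>k\<in>S. a k)"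
    using sum.permute[OF reflect_permutes, of a j] by (simp add: comp_def)
  finally show ?thesis using row_sum by (simp add: S_def)
qed

text \<open>The expected cluster size is a sum of connection weights, each bounded through
  \<open>rep i k\<close>. After expansion and summation over \<open>k\<close>, column sums 1 leave
  the bare minors.\<close>

lemma sum_minor_ge:
  assumes "i \<in> S"
  shows "(\<Sum>\<omega>\<in>P \<times> P. wt2 \<omega> * card (cl \<omega> i)) \<le> per * (\<Sum>j\<in>S. minor i j)"
proof -
  have card: "real (card (cl \<omega> i)) = (\<Sum>k\<in>S. of_bool (k \<in> cl \<omega> i))" if "\<omega> \<in> P \<times> P" for \<omega>
  proof -
    have "cl \<omega> i \<subseteq> S"
      using that assms cluster_subset_carrier[of "fst \<omega>" S "snd \<omega>" i] by (auto simp: cl_def P_def)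
    then have "S \<inter> {k. k \<in> cl \<omega> i} = cl \<omega> i" by blast
    then show ?thesis by (simp add: sum_of_bool_eq)
  qed
  have "(\<Sum>\<omega>\<in>P \<times> P. wt2 \<omega> * card (cl \<omega> i)) = (\<Sum>\<omega>\<in>P \<times> P. \<Sum>k\<in>S. wt2 \<omega> * of_bool (k \<in> cl \<omega> i))"
    by (rule sum.cong) (simp_all add: card sum_distrib_left)
  also have "\<dots> = (\<Sum>k\<in>S. \<Sum>\<omega>\<in>P \<times> P. wt2 \<omega> * of_bool (k \<in> cl \<omega> i))"
    by (rule sum.swap)
  also have "\<dots> \<le> (\<Sum>k\<in>S. per * rep i k)"
    by (rule sum_mono) (rule same_cluster_le_rep[OF assms])
  also have "\<dots> = per * (\<Sum>k\<in>S. \<Sum>j\<in>S. A k j * minor i j)"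
    by (simp add: rep_expand[OF assms] sum_distrib_left)
  also have "(\<Sum>k\<in>S. \<Sum>j\<in>S. A k j * minor i j) = (\<Sum>j\<in>S. \<Sum>k\<in>S. A k j * minor i j)"
    by (rule sum.swap)
  also have "\<dots> = (\<Sum>j\<in>S. minor i j)"
    by (rule sum.cong) (simp_all add: column_sum flip: sum_distrib_right)
  finally show ?thesis .
qed

lemma wt_conj_shift:
  assumes "\<sigma> \<in> P"
  shows "wt (shift t \<circ> \<sigma> \<circ> inv (shift t)) = wt \<sigma>"
  using assms unfolding wt_def perm_weight_conj[OF shift_permutes]
  by (intro perm_weight_cong) (auto simp: A_shift P_def)

text \<open>Translation by \<open>- i\<close> preserves the weights and moves \<open>i\<close> to
  0.\<close>

lemma cluster_tail_le_zero:
  assumes i: "i \<in> S"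
  shows "(\<Sum>\<omega>\<in>P \<times> P. wt2 \<omega> * of_bool (K \<le> real (card (cl \<omega> i))))
       \<le> (\<Sum>\<omega>\<in>P \<times> P. wt2 \<omega> * of_bool (K \<le> real (card (cl \<omega> 0))))"
proof -
  define \<rho> where "\<rho> = shift (- i)"
  have \<rho>: "\<rho> permutes S" unfolding \<rho>_def by (rule shift_permutes)
  have \<rho>i: "\<rho> i = 0" using i by (simp add: \<rho>_def shift_def)
  define T where "T = (\<lambda>\<sigma>. \<rho> \<circ> \<sigma> \<circ> inv \<rho>)"
  have "(\<Sum>\<omega>\<in>P \<times> P. wt2 \<omega> * of_bool (K \<le> real (card (cl \<omega> i))))
     = (\<Sum>\<sigma>\<in>P. \<Sum>\<tau>\<in>P. wt \<sigma> * wt \<tau> * of_bool (K \<le> real (card (cluster S \<sigma> \<tau> i))))"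
    unfolding sum.cartesian_product by (rule sum.cong) (auto simp: wt2_def cl_def)
  also have "\<dots> \<le> (\<Sum>\<sigma>\<in>P. \<Sum>\<tau>\<in>P. wt (T \<sigma>) * wt (T \<tau>) * of_bool (K \<le> real (card (cluster S (T \<sigma>) (T \<tau>) 0))))"
  proof (intro sum_mono)
    fix \<sigma> \<tau> assume st: "\<sigma> \<in> P" "\<tau> \<in> P"
    have wt: "wt (T \<sigma>) = wt \<sigma>" "wt (T \<tau>) = wt \<tau>"
      using wt_conj_shift st by (simp_all add: T_def \<rho>_def)
    have "card (cluster S \<sigma> \<tau> i) \<le> card (cluster S (T \<sigma>) (T \<tau>) 0)"
      unfolding T_def \<rho>i[symmetric]
      by (rule card_cluster_conj[OF finite_S \<rho> \<rho> _ _ i]) (use st in \<open>auto simp: P_def\<close>)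
    then show "wt \<sigma> * wt \<tau> * of_bool (K \<le> real (card (cluster S \<sigma> \<tau> i)))
      \<le> wt (T \<sigma>) * wt (T \<tau>) * of_bool (K \<le> real (card (cluster S (T \<sigma>) (T \<tau>) 0)))"
      unfolding wt by (intro mult_left_mono) (auto simp: wt_nonneg)
  qed
  also have "\<dots> = (\<Sum>\<sigma>\<in>P. \<Sum>\<tau>\<in>P. wt \<sigma> * wt \<tau> * of_bool (K \<le> real (card (cluster S \<sigma> \<tau> 0))))"
    unfolding T_def P_def
    by (subst sum_permutes_conj[OF \<rho> \<rho>, of "\<lambda>\<sigma>'. \<Sum>\<tau> | \<tau> permutes S. wt \<sigma>' * wt (\<rho> \<circ> \<tau> \<circ> inv \<rho>)
         * of_bool (K \<le> real (card (cluster S \<sigma>' (\<rho> \<circ> \<tau> \<circ> inv \<rho>) 0)))"],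
        rule sum.cong[OF refl],
        rule sum_permutes_conj[OF \<rho> \<rho>])
  also have "\<dots> = (\<Sum>\<omega>\<in>P \<times> P. wt2 \<omega> * of_bool (K \<le> real (card (cl \<omega> 0))))"
    unfolding sum.cartesian_product by (rule sum.cong) (auto simp: wt2_def cl_def)
  finally show ?thesis .
qed

end

subsection \<open>Winding\<close>

text \<open>If \<open>X\<^sub>0\<close> is not a single cluster, it splits into a smaller cluster
  and a balanced remainder, one of which still has nonzero sum; induction on the cardinality
  finishes. The result isolates one loop that carries winding.\<close>

lemma balanced_minimal:
  fixes f :: "'a \<Rightarrow> int"
  assumes fin: "finite S" and \<sigma>: "\<sigma> permutes S" and \<tau>: "\<tau> permutes S"
    and "balanced S \<sigma> \<tau> X\<^sub>0" "sum f X\<^sub>0 \<noteq> 0"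
  shows "\<exists>X. balanced S \<sigma> \<tau> X \<and> sum f X \<noteq> 0 \<and> (\<forall>i\<in>X. cluster S \<sigma> \<tau> i = X)"
  using assms(4,5)
proof (induction "card X\<^sub>0" arbitrary: X\<^sub>0 rule: less_induct)
  case less
  then have sub: "X\<^sub>0 \<subseteq> S" by (simp add: balanced_def)
  then have finX: "finite X\<^sub>0" using fin finite_subset by blast
  show ?case
  proof (cases "\<forall>i\<in>X\<^sub>0. cluster S \<sigma> \<tau> i = X\<^sub>0")
    case True
    then show ?thesis using less by blast
  next
    case False
    then obtain i where i: "i \<in> X\<^sub>0" "cluster S \<sigma> \<tau> i \<noteq> X\<^sub>0" by blast
    define c where "c = cluster S \<sigma> \<tau> i"
    have bc: "balanced S \<sigma> \<tau> c"
      unfolding c_def by (rule balanced_cluster[OF \<sigma> \<tau>]) (use i sub in auto)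
    have "c \<subseteq> X\<^sub>0" unfolding c_def by (rule cluster_subset[OF less.prems(1) i(1)])
    then have c: "c \<subset> X\<^sub>0" using i by (auto simp: c_def)
    have "i \<in> c" by (simp add: c_def self_in_cluster)
    then have "X\<^sub>0 - c \<subset> X\<^sub>0" using i by auto
    then have lt: "card c < card X\<^sub>0" "card (X\<^sub>0 - c) < card X\<^sub>0"
      using c finX psubset_card_mono by blast+
    have "sum f X\<^sub>0 = sum f (X\<^sub>0 - c) + sum f c"
      by (rule sum.subset_diff) (use c finX in auto)
    then consider "sum f c \<noteq> 0" | "sum f (X\<^sub>0 - c) \<noteq> 0" using less.prems(2) by fastforce
    then show ?thesis
    proof cases
      case 1
      then show ?thesis using less.hyps[OF lt(1) bc] by blast
    next
      case 2
      then show ?thesis using less.hyps[OF lt(2) balanced_Diff[OF \<sigma> \<tau> less.prems(1) bc]] by blast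
    qed
  qed
qed

context circulant
begin

text \<open>The representative of \<open>x\<close> modulo \<open>2 * int N\<close> of least absolute
  value, lying above \<open>- int N\<close> and at most \<open>int N\<close>; the tie goes to
  \<open>int N\<close>.\<close>

definition centre :: "int \<Rightarrow> int" where
  "centre x = (x + int N - 1) mod (2 * int N) - (int N - 1)"

lemma centre_bounds: "- int N < centre x" "centre x \<le> int N"
proof -
  have "0 \<le> (x + int N - 1) mod (2 * int N)" "(x + int N - 1) mod (2 * int N) < 2 * int N"
    using N_pos by simp_all
  then show "- int N < centre x" "centre x \<le> int N" unfolding centre_def by linarith+
qed

lemma centre_mod: "2 * int N dvd centre x - x"
proof -
  have "2 * int N dvd (x + int N - 1) mod (2 * int N) - (x + int N - 1)"
    by (simp add: mod_eq_dvd_iff[symmetric])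
  then show ?thesis by (simp add: centre_def algebra_simps)
qed

lemma centre_unique:
  assumes "2 * int N dvd y - x" "- int N < y" "y \<le> int N"
  shows "centre x = y"
proof -
  have "2 * int N dvd (centre x - x) - (y - x)" by (rule dvd_diff[OF centre_mod assms(1)])
  then have dvd: "2 * int N dvd centre x - y" by simp
  have "\<bar>centre x - y\<bar> < 2 * int N" using centre_bounds[of x] assms(2,3) by linarith
  then have "centre x - y = 0" using dvd dvd_imp_le_int[of "centre x - y" "2 * int N"] N_pos by auto
  then show ?thesis by simp
qed

lemma centre_cong: "2 * int N dvd x - y \<Longrightarrow> centre x = centre y"
  using centre_unique[of "centre y" x] centre_bounds[of y] dvd_diff[OF centre_mod[of y], of "x - y"]
  by simp

lemma abs_centre_le: "\<bar>centre x\<bar> \<le> \<bar>x + k * (2 * int N)\<bar>"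
proof (cases "\<bar>x + k * (2 * int N)\<bar> < int N")
  case True
  then have "centre x = x + k * (2 * int N)"
    by (intro centre_unique) auto
  then show ?thesis by simp
next
  case False
  then show ?thesis using centre_bounds[of x] by linarith
qed

text \<open>At a tie both \<open>x\<close> and \<open>- x\<close> have the representative
  \<open>int N\<close>, so oddness fails there.\<close>

lemma centre_minus: "\<bar>centre x\<bar> \<noteq> int N \<Longrightarrow> centre (- x) = - centre x"
  using centre_unique[of "- centre x" "- x"] centre_bounds[of x] centre_mod[of x]
    dvd_diff_commute[of "2 * int N" "centre x" x]
  by (simp add: algebra_simps abs_if split: if_splits)

lemma abs_centre_minus: "\<bar>centre (- x)\<bar> = \<bar>centre x\<bar>"
  using centre_minus[of x] centre_minus[of "- x"] by fastforce

text \<open>The signed shortest displacement on the torus from the even site \<open>2 * i\<close> to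
  the odd site \<open>2 * j + 1\<close>.\<close>

definition d :: "int \<Rightarrow> int \<Rightarrow> int" where
  "d i j = centre (2 * (j - i) + 1)"

definition long :: "real \<Rightarrow> int \<Rightarrow> real" where
  "long R x = (if \<bar>real_of_int x\<bar> > R then \<bar>real_of_int x\<bar> else 0)"

definition long_sum :: "real \<Rightarrow> (int \<Rightarrow> int) \<Rightarrow> real" where
  "long_sum R \<sigma> = (\<Sum>i\<in>S. long R (d i (\<sigma> i)))"

text \<open>
  The total displacement of the dimers from even to odd sites. It is congruent to \<open>N\<close> modulo \<open>2 N\<close>,
  so its sign is never \<open>0\<close>, and a reflection of the torus exchanges the two signs.
\<close>

definition winding :: "(int \<Rightarrow> int) \<Rightarrow> int" where
  "winding \<sigma> = (\<Sum>i\<in>S. d i (\<sigma> i))"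

text \<open>The threshold ensures that two good matchings together have less than \<open>N\<close>
  of long displacement, half of the \<open>2 * N\<close> that a winding loop must supply.\<close>

definition good :: "real \<Rightarrow> (int \<Rightarrow> int) \<Rightarrow> bool" where
  "good R \<sigma> \<longleftrightarrow> long_sum R \<sigma> < real N / 2"

lemma long_nonneg: "long R x \<ge> 0"
  by (simp add: long_def)

lemma abs_le_long: "R \<ge> 0 \<Longrightarrow> \<bar>real_of_int x\<bar> \<le> R + long R x"
  by (simp add: long_def)

text \<open>Before centring, the displacements \<open>2 * (\<sigma> i - i) + 1\<close> add up to
  exactly \<open>N\<close>, since \<open>\<sigma>\<close> permutes \<open>S\<close>. Centring
  changes each by a multiple of \<open>2 * N\<close>.\<close>

lemma winding_mod:
  assumes "\<sigma> permutes S"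
  shows "2 * int N dvd winding \<sigma> - int N"
proof -
  have "(\<Sum>i\<in>S. \<sigma> i) = (\<Sum>i\<in>S. i)"
    using sum.permute[OF assms, of "\<lambda>i. i"] by (simp add: comp_def)
  then have "(\<Sum>i\<in>S. 2 * (\<sigma> i - i) + 1) = int N"
    by (simp add: sum.distrib sum_subtractf flip: sum_distrib_left)
  then have "winding \<sigma> - int N = (\<Sum>i\<in>S. d i (\<sigma> i) - (2 * (\<sigma> i - i) + 1))"
    by (simp add: winding_def sum_subtractf)
  moreover have "2 * int N dvd (\<Sum>i\<in>S. d i (\<sigma> i) - (2 * (\<sigma> i - i) + 1))"
    by (rule dvd_sum) (simp only: d_def centre_mod)
  ultimately show ?thesis by simp
qed

lemma winding_nonzero: "\<sigma> permutes S \<Longrightarrow> winding \<sigma> \<noteq> 0"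
  using winding_mod[of \<sigma>] zdvd_imp_le[of "2 * int N" "int N"] N_pos by auto

text \<open>A displacement of exactly half the torus equals its own negative, which spoils the reflection.\<close>

lemma good_imp_no_tie:
  assumes "good R \<sigma>" "R < real N" "i \<in> S"
  shows "\<bar>d i (\<sigma> i)\<bar> \<noteq> int N"
proof
  assume *: "\<bar>d i (\<sigma> i)\<bar> = int N"
  then have "\<bar>real_of_int (d i (\<sigma> i))\<bar> = real N"
    by (metis of_int_abs of_int_of_nat_eq)
  then have "real N = long R (d i (\<sigma> i))" using assms(2) by (simp add: long_def)
  also have "\<dots> \<le> long_sum R \<sigma>" unfolding long_sum_def
    by (rule member_le_sum[of i S "\<lambda>i. long R (d i (\<sigma> i))"]) (use assms(3) long_nonneg in auto)
  also have "\<dots> < real N / 2" using assms(1) by (simp add: good_def)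
  finally show False by simp
qed

text \<open>The matching reflected by \<open>x \<mapsto> - x\<close>: the site
  \<open>2 * j + 1\<close> goes to \<open>2 * (- 1 - j) + 1\<close>, hence the parameter
  \<open>- 1\<close> on columns.\<close>

definition mirror :: "(int \<Rightarrow> int) \<Rightarrow> int \<Rightarrow> int" where
  "mirror \<sigma> = reflect (- 1) \<circ> \<sigma> \<circ> inv (reflect 0)"

lemma sum_mirror:
  "(\<Sum>i\<in>S. f i (mirror \<sigma> i)) = (\<Sum>i\<in>S. f (reflect 0 i) (reflect (- 1) (\<sigma> i)))"
  using sum.permute[OF reflect_permutes[of 0], of "\<lambda>i. f i (mirror \<sigma> i)"]
  by (simp add: comp_def mirror_def permutes_inverses[OF reflect_permutes])

lemma d_reflect:
  assumes "i \<in> S" "j \<in> S"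
  shows "d (reflect 0 i) (reflect (- 1) j) = centre (- (2 * (j - i) + 1))"
  unfolding d_def
proof (rule centre_cong)
  have "int N dvd ((- 1 - j) mod int N - (- 1 - j)) - ((- i) mod int N - (- i))"
    by (intro dvd_diff[of "int N" "(- 1 - j) mod int N - (- 1 - j)" "(- i) mod int N - (- i)"])
       (simp_all only: dvd_minus_mod dvd_diff_commute[of _ "_ mod _"])
  then have "2 * int N dvd 2 * (((- 1 - j) mod int N - (- 1 - j)) - ((- i) mod int N - (- i)))"
    by (rule mult_dvd_mono[OF dvd_refl])
  moreover have "2 * (((- 1 - j) mod int N - (- 1 - j)) - ((- i) mod int N - (- i)))
      = 2 * ((- 1 - j) mod int N - (- i) mod int N) + 1 - (- (2 * (j - i) + 1))"
    by (simp add: algebra_simps)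
  ultimately show "2 * int N dvd 2 * (reflect (- 1) j - reflect 0 i) + 1 - (- (2 * (j - i) + 1))"
    using assms by (simp only: reflect_def if_True diff_0)
qed

text \<open>Only absolute values enter, so ties do no harm and \<open>good\<close> is invariant
  under reflection.\<close>

lemma long_sum_mirror: "\<sigma> permutes S \<Longrightarrow> long_sum R (mirror \<sigma>) = long_sum R \<sigma>"
  unfolding long_sum_def sum_mirror[of "\<lambda>i j. long R (d i j)"]
proof (rule sum.cong)
  fix i assume "\<sigma> permutes S" "i \<in> S"
  then have "\<bar>d (reflect 0 i) (reflect (- 1) (\<sigma> i))\<bar> = \<bar>d i (\<sigma> i)\<bar>"
    using d_reflect[of i "\<sigma> i"] abs_centre_minus[of "2 * (\<sigma> i - i) + 1"]
    by (simp add: permutes_in_image d_def)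
  then show "long R (d (reflect 0 i) (reflect (- 1) (\<sigma> i))) = long R (d i (\<sigma> i))"
    unfolding long_def of_int_abs[symmetric] by simp
qed simp

lemma good_mirror: "\<sigma> permutes S \<Longrightarrow> good R (mirror \<sigma>) = good R \<sigma>"
  by (simp add: good_def long_sum_mirror)

lemma winding_mirror:
  assumes "\<sigma> permutes S" "good R \<sigma>" "R < real N"
  shows "winding (mirror \<sigma>) = - winding \<sigma>"
  unfolding winding_def sum_mirror[of d] sum_negf[symmetric]
proof (rule sum.cong)
  fix i assume i: "i \<in> S"
  then have "\<sigma> i \<in> S" using permutes_in_image[OF assms(1)] by simp
  then show "d (reflect 0 i) (reflect (- 1) (\<sigma> i)) = - d i (\<sigma> i)"
    using d_reflect[OF i] good_imp_no_tie[OF assms(2,3) i] centre_minus unfolding d_def by metis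
qed simp

lemma wt_mirror: "\<sigma> permutes S \<Longrightarrow> wt (mirror \<sigma>) = wt \<sigma>"
  unfolding wt_def mirror_def perm_weight_conj[OF reflect_permutes]
  by (rule perm_weight_cong) (use A_reflect[of _ _ 0] in auto)

lemma winding_symmetric:
  assumes "R < real N"
  shows "(\<Sum>\<sigma>\<in>P. wt \<sigma> * of_bool (good R \<sigma> \<and> winding \<sigma> > 0))
       = (\<Sum>\<sigma>\<in>P. wt \<sigma> * of_bool (good R \<sigma> \<and> winding \<sigma> < 0))"
proof -
  have "(\<Sum>\<sigma>\<in>P. wt \<sigma> * of_bool (good R \<sigma> \<and> winding \<sigma> < 0))
      = (\<Sum>\<sigma>\<in>P. wt (mirror \<sigma>) * of_bool (good R (mirror \<sigma>) \<and> winding (mirror \<sigma>) > 0))"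
  proof (rule sum.cong)
    fix \<sigma> assume "\<sigma> \<in> P"
    then have \<sigma>: "\<sigma> permutes S" by (simp add: P_def)
    show "wt \<sigma> * of_bool (good R \<sigma> \<and> winding \<sigma> < 0)
      = wt (mirror \<sigma>) * of_bool (good R (mirror \<sigma>) \<and> winding (mirror \<sigma>) > 0)"
      using winding_mirror[OF \<sigma> _ assms] by (auto simp: wt_mirror[OF \<sigma>] good_mirror[OF \<sigma>])
  qed simp
  also have "\<dots> = (\<Sum>\<sigma>\<in>P. wt \<sigma> * of_bool (good R \<sigma> \<and> winding \<sigma> > 0))"
    unfolding mirror_def P_def
    by (rule sum_permutes_conj[OF reflect_permutes reflect_permutes,
          of "\<lambda>\<sigma>. wt \<sigma> * of_bool (good R \<sigma> \<and> winding \<sigma> > 0)"])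
  finally show ?thesis by simp
qed

text \<open>The truncated first moment of the displacement of a single step with law
  \<open>a\<close>; by translation it is the same for every row.\<close>

definition tail :: "real \<Rightarrow> real" where
  "tail R = (\<Sum>u\<in>S. long R (centre (2 * u + 1)) * a u)"

lemma sum_long_row:
  assumes "i \<in> S"
  shows "(\<Sum>j\<in>S. long R (d i j) * A i j) = tail R"
proof -
  have "(\<Sum>j\<in>S. long R (d i j) * A i j) = (\<Sum>j\<in>S. long R (centre (2 * shift (- i) j + 1)) * a (shift (- i) j))"
  proof (rule sum.cong)
    fix j assume j: "j \<in> S"
    have "2 * int N dvd 2 * ((j - i) - (j - i) mod int N)"
      by (rule mult_dvd_mono[OF dvd_refl dvd_minus_mod])
    moreover have "2 * ((j - i) - (j - i) mod int N) = 2 * (j - i) + 1 - (2 * ((j - i) mod int N) + 1)"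
      by simp
    ultimately have "centre (2 * (j - i) + 1) = centre (2 * ((j - i) mod int N) + 1)"
      by (intro centre_cong) (simp only:)
    then show "long R (d i j) * A i j = long R (centre (2 * shift (- i) j + 1)) * a (shift (- i) j)"
      using j by (simp add: d_def A_def shift_def periodic)
  qed simp
  also have "\<dots> = tail R"
    unfolding tail_def
    using sum.permute[OF shift_permutes[of "- i"], of "\<lambda>u. long R (centre (2 * u + 1)) * a u"]
    by (simp add: comp_def)
  finally show ?thesis .
qed

lemma sum_wt_long_sum_le:
  assumes "a u \<ge> b" "b > 0"
  shows "(\<Sum>\<sigma>\<in>P. wt \<sigma> * long_sum R \<sigma>) \<le> real N * (sqrt 2 / b * per * tail R)"
proof -
  have "(\<Sum>\<sigma>\<in>P. wt \<sigma> * long_sum R \<sigma>) = (\<Sum>i\<in>S. \<Sum>j\<in>S. long R (d i j) * A i j * minor i j)"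
    unfolding P_def wt_def long_sum_def by (rule sum_perm_weight_local[OF finite_S])
  also have "\<dots> \<le> (\<Sum>i\<in>S. \<Sum>j\<in>S. long R (d i j) * A i j * (sqrt 2 / b * per))"
    by (intro sum_mono mult_left_mono minor_le[OF _ _ assms] mult_nonneg_nonneg long_nonneg A_nonneg)
  also have "\<dots> = (\<Sum>i\<in>S. tail R * (sqrt 2 / b * per))"
    by (rule sum.cong) (simp_all only: sum_distrib_right[symmetric] sum_long_row)
  finally show ?thesis by (simp add: mult_ac)
qed

text \<open>Markov's inequality at level \<open>N / 2\<close>: the factor 4 in the hypothesis brings
  the weighted long displacement down to \<open>N * per / 4\<close>, so matchings that are not good
  carry at most \<open>per / 2\<close>.\<close>

lemma good_weight:
  assumes "a u \<ge> b" "b > 0" "tail R * (4 * sqrt 2 / b) \<le> 1"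
  shows "(\<Sum>\<sigma>\<in>P. wt \<sigma> * of_bool (good R \<sigma>)) \<ge> per / 2"
proof -
  have "real N / 2 * (\<Sum>\<sigma>\<in>P. wt \<sigma> * of_bool (\<not> good R \<sigma>)) \<le> (\<Sum>\<sigma>\<in>P. wt \<sigma> * long_sum R \<sigma>)"
    unfolding sum_distrib_left
  proof (rule sum_mono)
    fix \<sigma>
    have "0 \<le> long_sum R \<sigma>" unfolding long_sum_def by (intro sum_nonneg long_nonneg)
    then have "real N / 2 * of_bool (\<not> good R \<sigma>) \<le> long_sum R \<sigma>"
      by (simp add: good_def)
    from mult_left_mono[OF this wt_nonneg[of \<sigma>]]
    show "real N / 2 * (wt \<sigma> * of_bool (\<not> good R \<sigma>)) \<le> wt \<sigma> * long_sum R \<sigma>"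
      by (simp add: mult_ac)
  qed
  also have "\<dots> \<le> real N * (sqrt 2 / b * per * tail R)" by (rule sum_wt_long_sum_le[OF assms(1,2)])
  also have "\<dots> = real N * (per * (tail R * (4 * sqrt 2 / b)) / 4)" by simp
  also have "\<dots> \<le> real N * (per * 1 / 4)"
    by (intro mult_left_mono divide_right_mono assms(3)) (simp_all add: per_nonneg)
  finally have "(\<Sum>\<sigma>\<in>P. wt \<sigma> * of_bool (\<not> good R \<sigma>)) \<le> per / 2"
    using N_pos by (simp add: field_simps)
  moreover have "per = (\<Sum>\<sigma>\<in>P. wt \<sigma> * of_bool (good R \<sigma>)) + (\<Sum>\<sigma>\<in>P. wt \<sigma> * of_bool (\<not> good R \<sigma>))"
    unfolding per_eq sum.distrib[symmetric] by (rule sum.cong) auto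
  ultimately show ?thesis by simp
qed

text \<open>The condition on all \<open>i\<close> in \<open>X\<close> says that \<open>X\<close> is
  one loop, so at least \<open>K\<close> rows see a large cluster at once; \<open>macro_zero\<close>
  counts them.\<close>

definition macro :: "real \<Rightarrow> (int \<Rightarrow> int) \<times> (int \<Rightarrow> int) \<Rightarrow> bool" where
  "macro K \<omega> \<longleftrightarrow> (\<exists>X\<subseteq>S. X \<noteq> {} \<and> K \<le> real (card X) \<and> (\<forall>i\<in>X. cl \<omega> i = X))"

lemma winding_macro:
  assumes \<sigma>: "\<sigma> permutes S" "good R \<sigma>" "winding \<sigma> > 0"
    and \<tau>: "\<tau> permutes S" "good R \<tau>" "winding \<tau> < 0" and R: "R > 0"
  shows "macro (real N / (2 * R)) (\<sigma>, \<tau>)"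
proof -
  \<comment> \<open>Around a loop, dimers of \<open>\<sigma>\<close> are traversed forwards and
    those of \<open>\<tau>\<close> backwards, so summing \<open>f\<close> over a cycle gives its net
    displacement.\<close>
  define f where "f i = d i (\<sigma> i) - d i (\<tau> i)" for i
  have "sum f S = winding \<sigma> - winding \<tau>" by (simp add: f_def winding_def sum_subtractf)
  then have "sum f S \<noteq> 0" using \<sigma>(3) \<tau>(3) by simp
  from balanced_minimal[OF finite_S \<sigma>(1) \<tau>(1) balanced_carrier[OF \<sigma>(1) \<tau>(1)] this]
  obtain X where X: "balanced S \<sigma> \<tau> X" "sum f X \<noteq> 0" "\<forall>i\<in>X. cluster S \<sigma> \<tau> i = X"
    by blast
  then have sub: "X \<subseteq> S" and img: "\<sigma> ` X = \<tau> ` X" by (auto simp: balanced_def)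
  have "(\<Sum>i\<in>X. \<sigma> i) = \<Sum>(\<sigma> ` X)" "(\<Sum>i\<in>X. \<tau> i) = \<Sum>(\<tau> ` X)"
    using sum.reindex[OF inj_on_subset[OF permutes_inj[OF \<sigma>(1)] subset_UNIV], of "\<lambda>i. i" X]
      sum.reindex[OF inj_on_subset[OF permutes_inj[OF \<tau>(1)] subset_UNIV], of "\<lambda>i. i" X] by simp_all
  \<comment> \<open>On a balanced set the column terms cancel, leaving only the centring
    corrections, which are multiples of \<open>2 * N\<close>.\<close>
  then have "(\<Sum>i\<in>X. \<sigma> i) = (\<Sum>i\<in>X. \<tau> i)" using img by simp
  then have "sum f X = (\<Sum>i\<in>X. (d i (\<sigma> i) - (2 * (\<sigma> i - i) + 1)) - (d i (\<tau> i) - (2 * (\<tau> i - i) + 1)))"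
    by (simp add: f_def sum_subtractf sum.distrib flip: sum_distrib_left)
  moreover have "2 * int N dvd \<dots>"
    unfolding d_def by (intro dvd_sum dvd_diff[OF centre_mod centre_mod])
  ultimately have "2 * int N dvd sum f X" by simp
  then have "2 * int N \<le> \<bar>sum f X\<bar>" using dvd_imp_le_int[OF X(2), of "2 * int N"] by simp
  then have "2 * real N \<le> real_of_int \<bar>sum f X\<bar>" by linarith
  also have "\<dots> \<le> (\<Sum>i\<in>X. \<bar>real_of_int (f i)\<bar>)" by (simp add: sum_abs)
  also have "\<dots> \<le> (\<Sum>i\<in>X. 2 * R + long R (d i (\<sigma> i)) + long R (d i (\<tau> i)))"
  proof (rule sum_mono)
    fix i
    show "\<bar>real_of_int (f i)\<bar> \<le> 2 * R + long R (d i (\<sigma> i)) + long R (d i (\<tau> i))"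
      using abs_le_long[of R "d i (\<sigma> i)"] abs_le_long[of R "d i (\<tau> i)"] R
      by (simp add: f_def)
  qed
  also have "\<dots> = 2 * R * card X + (\<Sum>i\<in>X. long R (d i (\<sigma> i))) + (\<Sum>i\<in>X. long R (d i (\<tau> i)))"
    by (simp add: sum.distrib)
  also have "\<dots> \<le> 2 * R * card X + long_sum R \<sigma> + long_sum R \<tau>"
    unfolding long_sum_def by (intro add_mono order_refl sum_mono2) (use sub long_nonneg in auto)
  also have "\<dots> \<le> 2 * R * card X + real N" using \<sigma>(2) \<tau>(2) by (simp add: good_def)
  finally have "real N / (2 * R) \<le> card X" using R by (simp add: field_simps)
  moreover have "X \<noteq> {}" using X(2) by auto
  ultimately show ?thesis using sub X(3) unfolding macro_def cl_def by auto
qed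

text \<open>Every cluster is large enough here; the constant function 1 makes
  \<open>balanced_minimal\<close> return one.\<close>

lemma small_macro:
  assumes "\<omega> \<in> P \<times> P" "K \<le> 1"
  shows "macro K \<omega>"
proof -
  have p: "fst \<omega> permutes S" "snd \<omega> permutes S" using assms(1) by (auto simp: P_def)
  have "sum (\<lambda>_. 1 :: int) S \<noteq> 0" using N_pos by simp
  from balanced_minimal[OF finite_S p balanced_carrier[OF p] this]
  obtain X where X: "balanced S (fst \<omega>) (snd \<omega>) X" "sum (\<lambda>_. 1 :: int) X \<noteq> 0" "\<forall>i\<in>X. cl \<omega> i = X"
    unfolding cl_def by blast
  then have "X \<noteq> {}" by auto
  have sub: "X \<subseteq> S" using X(1) by (simp add: balanced_def)
  then have "card X \<ge> 1" using \<open>X \<noteq> {}\<close> finite_subset[OF _ finite_S] by (simp add: Suc_le_eq card_gt_0_iff)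
  then have "K \<le> real (card X)" using assms(2) by linarith
  then show ?thesis using sub X(3) \<open>X \<noteq> {}\<close> unfolding macro_def by blast
qed

lemma macro_weight:
  assumes "a u \<ge> b" "b > 0" "tail R * (4 * sqrt 2 / b) \<le> 1" "R \<ge> 1"
  shows "(\<Sum>\<omega>\<in>P \<times> P. wt2 \<omega> * of_bool (macro (real N / (2 * R)) \<omega>)) \<ge> per\<^sup>2 / 16"
proof (cases "R < real N")
  \<comment> \<open>On these small tori ties cannot be excluded, but the required cluster size is at
    most 1.\<close>
  case False
  then have "real N / (2 * R) \<le> 1" using assms(4) by (simp add: field_simps)
  then have "(\<Sum>\<omega>\<in>P \<times> P. wt2 \<omega> * of_bool (macro (real N / (2 * R)) \<omega>)) = per\<^sup>2"
    unfolding per_square by (intro sum.cong refl) (simp add: small_macro)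
  then show ?thesis by simp
next
  case True
  let ?p = "\<lambda>\<sigma>. of_bool (good R \<sigma> \<and> winding \<sigma> > 0) :: real"
  let ?m = "\<lambda>\<sigma>. of_bool (good R \<sigma> \<and> winding \<sigma> < 0) :: real"
  have "(\<Sum>\<sigma>\<in>P. wt \<sigma> * of_bool (good R \<sigma>)) = (\<Sum>\<sigma>\<in>P. wt \<sigma> * ?p \<sigma>) + (\<Sum>\<sigma>\<in>P. wt \<sigma> * ?m \<sigma>)"
    unfolding sum.distrib[symmetric]
  proof (rule sum.cong)
    fix \<sigma> assume "\<sigma> \<in> P"
    then have "winding \<sigma> \<noteq> 0" using winding_nonzero by (simp add: P_def)
    then show "wt \<sigma> * of_bool (good R \<sigma>) = wt \<sigma> * ?p \<sigma> + wt \<sigma> * ?m \<sigma>" by auto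
  qed simp
  \<comment> \<open>The good weight, at least \<open>per / 2\<close>, is shared equally by the two
    signs; independence of the two matchings then gives 1/4 times 1/4.\<close>
  then have ge: "(\<Sum>\<sigma>\<in>P. wt \<sigma> * ?p \<sigma>) \<ge> per / 4" "(\<Sum>\<sigma>\<in>P. wt \<sigma> * ?m \<sigma>) \<ge> per / 4"
    using good_weight[OF assms(1-3)] winding_symmetric[OF True] by linarith+
  have "per\<^sup>2 / 16 = (per / 4) * (per / 4)" by (simp add: power2_eq_square)
  also have "\<dots> \<le> (\<Sum>\<sigma>\<in>P. wt \<sigma> * ?p \<sigma>) * (\<Sum>\<sigma>\<in>P. wt \<sigma> * ?m \<sigma>)"
    by (rule mult_mono) (use ge per_nonneg in auto)
  also have "\<dots> = (\<Sum>\<omega>\<in>P \<times> P. wt2 \<omega> * (?p (fst \<omega>) * ?m (snd \<omega>)))"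
    unfolding sum_product sum.cartesian_product by (rule sum.cong) (auto simp: wt2_def mult_ac)
  also have "\<dots> \<le> (\<Sum>\<omega>\<in>P \<times> P. wt2 \<omega> * of_bool (macro (real N / (2 * R)) \<omega>))"
  proof (intro sum_mono mult_left_mono wt2_nonneg)
    fix \<omega> assume "\<omega> \<in> P \<times> P"
    then show "?p (fst \<omega>) * ?m (snd \<omega>) \<le> of_bool (macro (real N / (2 * R)) \<omega>)"
      using winding_macro[of "fst \<omega>" R "snd \<omega>"] assms(4) by (auto simp: P_def)
  qed
  finally show ?thesis .
qed

lemma macro_imp_cluster: "macro K \<omega> \<Longrightarrow> \<exists>i\<in>S. K \<le> real (card (cl \<omega> i))"
  unfolding macro_def by fastforce

text \<open>Double counting: a large loop contributes at least \<open>K\<close> rows with a large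
  cluster, and by translation each of the \<open>N\<close> rows contributes at most what row 0
  does.\<close>

lemma macro_zero:
  assumes "K \<ge> 0"
  shows "K * (\<Sum>\<omega>\<in>P \<times> P. wt2 \<omega> * of_bool (macro K \<omega>))
    \<le> real N * (\<Sum>\<omega>\<in>P \<times> P. wt2 \<omega> * of_bool (K \<le> real (card (cl \<omega> 0))))"
proof -
  have "K * (\<Sum>\<omega>\<in>P \<times> P. wt2 \<omega> * of_bool (macro K \<omega>))
     \<le> (\<Sum>\<omega>\<in>P \<times> P. wt2 \<omega> * (\<Sum>i\<in>S. of_bool (K \<le> real (card (cl \<omega> i)))))"
    unfolding sum_distrib_left[of K]
  proof (rule sum_mono)
    fix \<omega>
    have "K * of_bool (macro K \<omega>) \<le> (\<Sum>i\<in>S. of_bool (K \<le> real (card (cl \<omega> i))))"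
    proof (cases "macro K \<omega>")
      case True
      then obtain X where X: "X \<subseteq> S" "K \<le> real (card X)" "\<forall>i\<in>X. cl \<omega> i = X"
        by (auto simp: macro_def)
      have "K \<le> (\<Sum>i\<in>X. of_bool (K \<le> real (card (cl \<omega> i))))" using X by simp
      also have "\<dots> \<le> (\<Sum>i\<in>S. of_bool (K \<le> real (card (cl \<omega> i))))"
        by (rule sum_mono2[OF finite_S X(1)]) simp
      finally show ?thesis using True by simp
    next
      case False
      then show ?thesis by (simp add: sum_nonneg)
    qed
    from mult_left_mono[OF this wt2_nonneg[of \<omega>]]
    show "K * (wt2 \<omega> * of_bool (macro K \<omega>)) \<le> wt2 \<omega> * (\<Sum>i\<in>S. of_bool (K \<le> real (card (cl \<omega> i))))"
      by (simp only: mult_ac)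
  qed
  also have "\<dots> = (\<Sum>i\<in>S. \<Sum>\<omega>\<in>P \<times> P. wt2 \<omega> * of_bool (K \<le> real (card (cl \<omega> i))))"
    unfolding sum_distrib_left by (rule sum.swap)
  also have "\<dots> \<le> (\<Sum>i\<in>S. \<Sum>\<omega>\<in>P \<times> P. wt2 \<omega> * of_bool (K \<le> real (card (cl \<omega> 0))))"
    by (rule sum_mono) (rule cluster_tail_le_zero)
  finally show ?thesis by simp
qed

text \<open>The translation by \<open>u\<close> is a permutation all of whose entries equal
  \<open>a u\<close>.\<close>

lemma per_pos:
  assumes "a u > 0"
  shows "per > 0"
proof -
  have "wt (shift u) = (\<Prod>i\<in>S. a u)"
    unfolding wt_def perm_weight_def
    by (intro prod.cong refl) (auto simp: A_def shift_def mod_simps intro!: a_cong)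
  then have "wt (shift u) > 0" using assms by (simp add: prod_pos)
  also have "wt (shift u) \<le> per"
    unfolding per_eq by (rule member_le_sum) (simp_all add: P_def[THEN eq_reflection] shift_permutes wt_nonneg finite_permutations)
  finally show ?thesis .
qed

end

subsection \<open>Periodised weights\<close>

definition circ :: "(int \<Rightarrow> real) \<Rightarrow> nat \<Rightarrow> int \<Rightarrow> real" where
  "circ w N u = periodised_weight w (2 * N) 0 (2 * u + 1)"

lemma periodised_weight_uminus:
  assumes "\<And>r. w r = w (- r)"
  shows "periodised_weight w L x y = periodised_weight w L y x"
proof -
  have "bij (uminus :: int \<Rightarrow> int)" by (rule bij_uminus)
  then have "(\<Sum>\<^sub>\<infinity>k. w (y - x + (- k) * int L)) = (\<Sum>\<^sub>\<infinity>k. w (y - x + k * int L))"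
    by (rule infsum_reindex_bij_betw)
  moreover have "w (y - x + (- k) * int L) = w (x - y + k * int L)" for k
    using assms[of "x - y + k * int L"] by (simp add: algebra_simps)
  ultimately show ?thesis by (simp add: periodised_weight_def)
qed

lemma periodised_weight_translate:
  "periodised_weight w L x (y + c * int L) = periodised_weight w L x y"
proof -
  have "bij (\<lambda>k. k + c)" by (rule bij_betw_byWitness[of _ "\<lambda>k. k - c"]) auto
  then have "(\<Sum>\<^sub>\<infinity>k. w (y - x + (k + c) * int L)) = (\<Sum>\<^sub>\<infinity>k. w (y - x + k * int L))"
    by (rule infsum_reindex_bij_betw)
  moreover have "y - x + (k + c) * int L = y + c * int L - x + k * int L" for k
    by (simp add: algebra_simps)
  ultimately show ?thesis by (simp add: periodised_weight_def)
qed

lemma double_div_mod: "2 * (v mod n) + v div n * (2 * n) = 2 * v" for v n :: int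
proof -
  have "2 * (v div n * n + v mod n) = 2 * v" by (simp only: div_mult_mod_eq)
  then show ?thesis by (simp only: distrib_left mult_ac add_ac)
qed

text \<open>Each odd integer is uniquely a displacement \<open>2 * u + 1\<close> on the torus
  together with a number \<open>k\<close> of turns, so sums over the torus unfold to sums over the
  odd integers.\<close>

lemma bij_betw_odd_residues:
  assumes "N > 0"
  shows "bij_betw (\<lambda>(u, k). 2 * u + 1 + k * int (2 * N)) ({0..<int N} \<times> UNIV) {r. odd r}"
proof (rule bij_betw_byWitness[of _ "\<lambda>r. ((r div 2) mod int N, (r div 2) div int N)"])
  show "\<forall>x\<in>{0..<int N} \<times> UNIV.
      (case (case x of (u, k) \<Rightarrow> 2 * u + 1 + k * int (2 * N)) of
        r \<Rightarrow> ((r div 2) mod int N, (r div 2) div int N)) = x"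
  proof
    fix x :: "int \<times> int" assume x: "x \<in> {0..<int N} \<times> UNIV"
    obtain u k where uk: "x = (u, k)" by (cases x)
    then have u: "0 \<le> u" "u < int N" using x by auto
    have "2 * u + 1 + k * int (2 * N) = 2 * (u + k * int N) + 1" by (simp add: algebra_simps)
    then have "(2 * u + 1 + k * int (2 * N)) div 2 = u + k * int N" by simp
    moreover have "(u + k * int N) mod int N = u" "(u + k * int N) div int N = k"
      using u by simp_all
    ultimately show "(case (case x of (u, k) \<Rightarrow> 2 * u + 1 + k * int (2 * N)) of
        r \<Rightarrow> ((r div 2) mod int N, (r div 2) div int N)) = x"
      by (simp add: uk)
  qed
  have "2 * ((r div 2) mod int N) + 1 + ((r div 2) div int N) * int (2 * N) = r" if "odd r" for r :: int
  proof -
    have "2 * ((r div 2) mod int N) + 1 + ((r div 2) div int N) * int (2 * N) = 2 * (r div 2) + 1"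
      using double_div_mod[of "r div 2" "int N"] by simp
    then show ?thesis using that by simp
  qed
  then show "\<forall>r\<in>{r. odd r}. (case ((r div 2) mod int N, (r div 2) div int N) of
      (u, k) \<Rightarrow> 2 * u + 1 + k * int (2 * N)) = r" by simp
qed (use assms in auto)

lemma infsum_odd_residues:
  fixes F :: "int \<Rightarrow> real"
  assumes "N > 0" "F summable_on UNIV" "\<And>r. even r \<Longrightarrow> F r = 0"
  shows "(\<Sum>u\<in>{0..<int N}. \<Sum>\<^sub>\<infinity>k. F (2 * u + 1 + k * int (2 * N))) = infsum F UNIV"
    and "(\<lambda>k. F (2 * u + 1 + k * int (2 * N))) summable_on UNIV"
proof -
  let ?T = "\<lambda>(u, k). 2 * u + 1 + k * int (2 * N)"
  note bij = bij_betw_odd_residues[OF assms(1)]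
  have odd: "F summable_on {r. odd r}" by (rule summable_on_subset_banach[OF assms(2)]) simp
  have "(\<lambda>x. F (?T x)) summable_on ({0..<int N} \<times> UNIV)"
    using summable_on_reindex_bij_betw[OF bij, of F] odd by simp
  then have "(\<lambda>(u, k). F (2 * u + 1 + k * int (2 * N))) summable_on (SIGMA u:{0..<int N}. UNIV)"
    by (rule summable_on_cong[THEN iffD1, rotated]) auto
  then have "(\<Sum>\<^sub>\<infinity>u\<in>{0..<int N}. \<Sum>\<^sub>\<infinity>k. F (2 * u + 1 + k * int (2 * N)))
      = infsum (\<lambda>(u, k). F (2 * u + 1 + k * int (2 * N))) ({0..<int N} \<times> UNIV)"
    by (rule infsum_Sigma'_banach)
  also have "\<dots> = infsum (\<lambda>x. F (?T x)) ({0..<int N} \<times> UNIV)"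
    by (rule infsum_cong) auto
  also have "\<dots> = infsum F {r. odd r}" by (rule infsum_reindex_bij_betw[OF bij])
  also have "\<dots> = infsum F UNIV" by (rule infsum_cong_neutral) (use assms(3) in auto)
  finally show "(\<Sum>u\<in>{0..<int N}. \<Sum>\<^sub>\<infinity>k. F (2 * u + 1 + k * int (2 * N))) = infsum F UNIV"
    by simp
  have "inj (\<lambda>k. 2 * u + 1 + k * int (2 * N))" using assms(1) by (auto simp: inj_def)
  then have "(F summable_on range (\<lambda>k. 2 * u + 1 + k * int (2 * N)))
      = ((F \<circ> (\<lambda>k. 2 * u + 1 + k * int (2 * N))) summable_on UNIV)"
    by (rule summable_on_reindex)
  moreover have "F summable_on range (\<lambda>k. 2 * u + 1 + k * int (2 * N))"
    by (rule summable_on_subset_banach[OF assms(2)]) simp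
  ultimately show "(\<lambda>k. F (2 * u + 1 + k * int (2 * N))) summable_on UNIV"
    by (simp add: comp_def)
qed

lemma infsum_abs_tail_le:
  fixes g :: "int \<Rightarrow> real"
  assumes "g summable_on UNIV" "\<And>r. g r \<ge> 0" "\<delta> > 0"
  shows "\<exists>R\<ge>1. (\<Sum>\<^sub>\<infinity>r. if \<bar>real_of_int r\<bar> > R then g r else 0) \<le> \<delta>"
proof -
  have "(g has_sum infsum g UNIV) UNIV" using assms(1) by (rule has_sum_infsum)
  from has_sum_finite_approximation[OF this assms(3)]
  obtain X where X: "finite X" "dist (sum g X) (infsum g UNIV) \<le> \<delta>" by blast
  \<comment> \<open>Inserting 1 covers an empty \<open>X\<close> and provides the lower bound on
    \<open>R\<close> that \<open>macro_weight\<close> uses.\<close>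
  define R where "R = Max (insert 1 ((\<lambda>r. \<bar>real_of_int r\<bar>) ` X))"
  have R: "R \<ge> 1" unfolding R_def by (rule Max_ge) (use X in auto)
  have far: "r \<notin> X" if "\<bar>real_of_int r\<bar> > R" for r
  proof
    assume "r \<in> X"
    then have "\<bar>real_of_int r\<bar> \<le> R" unfolding R_def by (intro Max_ge) (use X in auto)
    then show False using that by simp
  qed
  have "(\<Sum>\<^sub>\<infinity>r. if \<bar>real_of_int r\<bar> > R then g r else 0) \<le> infsum g (UNIV - X)"
  proof (rule infsum_mono_neutral)
    show "(\<lambda>r. if \<bar>real_of_int r\<bar> > R then g r else 0) summable_on UNIV"
      by (rule summable_on_comparison_test[OF assms(1)]) (auto simp: assms(2))
    show "g summable_on UNIV - X" by (rule summable_on_subset_banach[OF assms(1)]) simp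
  qed (use far assms(2) in auto)
  also have "\<dots> = infsum g UNIV - infsum g X"
    by (rule infsum_Diff) (use assms(1) X(1) in auto)
  also have "\<dots> \<le> \<delta>"
    using X by (simp add: dist_real_def)
  finally show ?thesis using R by blast
qed

lemma circulant_circ:
  assumes nonneg: "\<And>r. w r \<ge> 0" and symmetric: "\<And>r. w r = w (- r)"
    and normalised: "(w has_sum 1) UNIV" and bipartite: "\<And>r. even r \<Longrightarrow> w r = 0"
    and "N > 0"
  shows "circulant N (circ w N)"
proof
  show "N > 0" by fact
  show "circ w N (u mod int N) = circ w N u" for u
  proof -
    have "2 * u + 1 = 2 * (u mod int N) + 1 + u div int N * int (2 * N)"
      using double_div_mod[of u "int N"] by simp
    then show ?thesis unfolding circ_def by (simp only: periodised_weight_translate)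
  qed
  show "circ w N (- 1 - u) = circ w N u" for u
  proof -
    have "circ w N u = periodised_weight w (2 * N) (2 * u + 1) 0"
      unfolding circ_def
      by (rule periodised_weight_uminus) (rule symmetric)
    moreover have "0 - (2 * u + 1) = 2 * (- 1 - u) + 1 - 0" by simp
    ultimately show ?thesis by (simp only: circ_def periodised_weight_def)
  qed
  show "circ w N u \<ge> 0" for u
    unfolding circ_def periodised_weight_def by (rule infsum_nonneg) (rule nonneg)
  have "w summable_on UNIV" using normalised by (rule has_sum_imp_summable)
  from infsum_odd_residues(1)[OF \<open>N > 0\<close> this bipartite] infsumI[OF normalised]
  show "(\<Sum>u\<in>{0..<int N}. circ w N u) = 1" by (simp add: circ_def periodised_weight_def)
qed

lemma circ_ge:
  assumes nonneg: "\<And>r. w r \<ge> 0" and sum: "w summable_on UNIV" and bipartite: "\<And>r. even r \<Longrightarrow> w r = 0"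
    and "N > 0"
  shows "w (2 * u + 1) \<le> circ w N u"
proof -
  have "sum (\<lambda>k. w (2 * u + 1 + k * int (2 * N))) {0} \<le> (\<Sum>\<^sub>\<infinity>k. w (2 * u + 1 + k * int (2 * N)))"
    by (rule finite_sum_le_infsum[OF infsum_odd_residues(2)[OF \<open>N > 0\<close> sum bipartite]]) (use nonneg in auto)
  then show ?thesis by (simp add: circ_def periodised_weight_def)
qed

text \<open>The centred representative is no longer than any unfolded displacement
  (\<open>abs_centre_le\<close>), so folding \<open>w\<close> onto the torus cannot increase the
  truncated first moment. The bound is uniform in \<open>N\<close>.\<close>

lemma tail_circ_le:
  assumes nonneg: "\<And>r. w r \<ge> 0" and symmetric: "\<And>r. w r = w (- r)"
    and normalised: "(w has_sum 1) UNIV" and bipartite: "\<And>r. even r \<Longrightarrow> w r = 0"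
    and first_moment: "(\<lambda>r. \<bar>real_of_int r\<bar> * w r) summable_on UNIV" and "N > 0" and R: "R \<ge> 0"
  shows "circulant.tail N (circ w N) R
     \<le> (\<Sum>\<^sub>\<infinity>r. if \<bar>real_of_int r\<bar> > R then \<bar>real_of_int r\<bar> * w r else 0)"
proof -
  interpret circulant N "circ w N" using assms by (intro circulant_circ)
  define F where "F r = (if \<bar>real_of_int r\<bar> > R then \<bar>real_of_int r\<bar> * w r else 0)" for r
  have "w summable_on UNIV" using normalised by (rule has_sum_imp_summable)
  note summable_w = infsum_odd_residues(2)[OF \<open>N > 0\<close> this bipartite]
  have "F summable_on UNIV"
    by (rule summable_on_comparison_test[OF first_moment]) (auto simp: F_def intro!: mult_nonneg_nonneg assms(1))
  note F = infsum_odd_residues[OF \<open>N > 0\<close> this]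
  have F0: "F r = 0" if "even r" for r using bipartite[OF that] by (simp add: F_def)
  have "tail R \<le> (\<Sum>u\<in>{0..<int N}. \<Sum>\<^sub>\<infinity>k. F (2 * u + 1 + k * int (2 * N)))"
    unfolding tail_def S_def
  proof (rule sum_mono)
    fix u
    let ?l = "long R (centre (2 * u + 1))"
    have "?l * circ w N u = (\<Sum>\<^sub>\<infinity>k. ?l * w (2 * u + 1 + k * int (2 * N)))"
      unfolding circ_def periodised_weight_def by (simp add: infsum_cmult_right')
    also have "\<dots> \<le> (\<Sum>\<^sub>\<infinity>k. F (2 * u + 1 + k * int (2 * N)))"
    proof (rule infsum_mono)
      show "(\<lambda>k. ?l * w (2 * u + 1 + k * int (2 * N))) summable_on UNIV"
        by (rule summable_on_cmult_right[OF summable_w])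
      show "(\<lambda>k. F (2 * u + 1 + k * int (2 * N))) summable_on UNIV"
        by (rule F(2)[OF F0])
      fix k
      let ?r = "2 * u + 1 + k * int (2 * N)"
      have "\<bar>centre (2 * u + 1)\<bar> \<le> \<bar>?r\<bar>" using abs_centre_le[of "2 * u + 1" k] by simp
      then have *: "\<bar>real_of_int (centre (2 * u + 1))\<bar> \<le> \<bar>real_of_int ?r\<bar>" by linarith
      show "?l * w ?r \<le> F ?r"
      proof (cases "\<bar>real_of_int (centre (2 * u + 1))\<bar> > R")
        case True
        then have "\<bar>real_of_int ?r\<bar> > R" using * by linarith
        then show ?thesis using True mult_right_mono[OF * assms(1)[of ?r]] by (simp only: long_def F_def if_True)
      next
        case False
        then have "?l = 0" by (simp add: long_def)
        moreover have "F ?r \<ge> 0" using assms(1) by (simp add: F_def)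
        ultimately show ?thesis by simp
      qed
    qed
    finally show "?l * circ w N u \<le> (\<Sum>\<^sub>\<infinity>k. F (2 * u + 1 + k * int (2 * N)))" .
  qed
  also have "\<dots> = infsum F UNIV" by (rule F(1)[OF F0])
  finally show ?thesis by (simp only: F_def[abs_def])
qed

text \<open>One odd \<open>r\<close> with \<open>w r > 0\<close> gives \<open>u\<close> and
  \<open>b\<close>; periodisation only adds nonnegative terms, so \<open>b\<close> survives for
  every \<open>N\<close>. Then \<open>R\<close> is taken from the convergent first moment.\<close>

lemma circ_constants:
  assumes nonneg: "\<And>r. w r \<ge> 0" and symmetric: "\<And>r. w r = w (- r)"
    and normalised: "(w has_sum 1) UNIV" and bipartite: "\<And>r. even r \<Longrightarrow> w r = 0"
    and first_moment: "(\<lambda>r. \<bar>real_of_int r\<bar> * w r) summable_on UNIV"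
  shows "\<exists>R b u. R \<ge> 1 \<and> b > 0 \<and>
    (\<forall>N>0. circ w N u \<ge> b \<and> circulant.tail N (circ w N) R * (4 * sqrt 2 / b) \<le> 1)"
proof -
  have "\<exists>r. w r \<noteq> 0"
  proof (rule ccontr)
    assume "\<not> ?thesis"
    then have "w = (\<lambda>_. 0)" by auto
    then have "infsum w UNIV = 0" by simp
    then show False using infsumI[OF normalised] by simp
  qed
  then obtain r where r: "w r \<noteq> 0" by blast
  then have "odd r" using bipartite by blast
  then obtain u where u: "r = 2 * u + 1" by (elim oddE)
  define b where "b = w r"
  have b: "b > 0" using r nonneg[of r] by (simp add: b_def)
  obtain R where R: "R \<ge> 1"
    "(\<Sum>\<^sub>\<infinity>r. if \<bar>real_of_int r\<bar> > R then \<bar>real_of_int r\<bar> * w r else 0) \<le> b / (4 * sqrt 2)"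
    using infsum_abs_tail_le[OF first_moment, of "b / (4 * sqrt 2)"] b nonneg by auto
  have "circ w N u \<ge> b \<and> circulant.tail N (circ w N) R * (4 * sqrt 2 / b) \<le> 1" if "N > 0" for N
  proof
    show "circ w N u \<ge> b" unfolding b_def u
      by (rule circ_ge[OF nonneg has_sum_imp_summable[OF normalised] bipartite that])
    have "circulant.tail N (circ w N) R \<le> b / (4 * sqrt 2)"
      using tail_circ_le[OF nonneg symmetric normalised bipartite first_moment that, of R] R
      by linarith
    then have "circulant.tail N (circ w N) R * (4 * sqrt 2 / b) \<le> b / (4 * sqrt 2) * (4 * sqrt 2 / b)"
      by (rule mult_right_mono) (use b in simp)
    then show "circulant.tail N (circ w N) R * (4 * sqrt 2 / b) \<le> 1" using b by simp
  qed
  then show ?thesis using R b by blast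
qed

subsection \<open>Configurations as pairs of permutations\<close>

lemma edge_weight_doubleton:
  assumes "\<And>x y. W x y = W y x"
  shows "edge_weight W {x, y} = W x y"
  unfolding edge_weight_def
proof (rule the_equality)
  show "\<exists>x' y'. {x, y} = {x', y'} \<and> W x y = W x' y'" by blast
  show "r = W x y" if "\<exists>x' y'. {x, y} = {x', y'} \<and> r = W x' y'" for r
    using that assms by (auto simp: doubleton_eq_iff)
qed

lemma mdd_weight_nonneg:
  assumes "\<And>x y. W x y = W y x" "\<And>z. W z z \<ge> 0"
  shows "mdd_weight V W U \<omega> \<ge> 0"
proof -
  have "edge_weight W e \<ge> 0" if "e \<in> mdd_edges V W" for e
    using that by (auto simp: mdd_edges_def edge_weight_doubleton[OF assms(1)])
  then show ?thesis
    by (auto simp: mdd_weight_def case_prod_beta intro!: mult_nonneg_nonneg prod_nonneg zero_le_power assms(2))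
qed

lemma finite_mdd_edges: "finite V \<Longrightarrow> finite (mdd_edges V W)"
  by (rule finite_subset[of _ "Pow V"]) (auto simp: mdd_edges_def)

lemma finite_dimer_families: "finite V \<Longrightarrow> finite (dimer_families V W)"
  by (simp add: dimer_families_def finite_PiE finite_mdd_edges)

lemma finite_mdd_configs: "finite V \<Longrightarrow> finite (mdd_configs V W)"
  by (rule finite_subset[of _ "dimer_families V W \<times> dimer_families V W"])
     (auto simp: mdd_configs_def finite_dimer_families)

lemma finite_mdd_two_point_configs: "finite V \<Longrightarrow> finite (mdd_two_point_configs V W x y)"
  by (rule finite_subset[of _ "dimer_families V W \<times> dimer_families V W"])
     (auto simp: mdd_two_point_configs_def finite_dimer_families)

lemma mdd_partition_nonneg:
  assumes "\<And>x y. W x y = W y x" "\<And>z. W z z \<ge> 0"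
  shows "mdd_partition V W \<ge> 0"
  unfolding mdd_partition_def by (intro sum_nonneg mdd_weight_nonneg assms)

lemma mdd_two_point_nonneg:
  assumes "\<And>x y. W x y = W y x" "\<And>z. W z z \<ge> 0"
  shows "mdd_two_point V W x y \<ge> 0"
  unfolding mdd_two_point_def
  by (auto intro!: divide_nonneg_nonneg sum_nonneg mdd_weight_nonneg mdd_partition_nonneg assms)

lemma prob_mdd_measure:
  assumes "finite V" "\<And>x y. W x y = W y x" "\<And>z. W z z \<ge> 0"
  shows "\<P>(\<omega> in mdd_measure V W. Q \<omega>)
    = (\<Sum>\<omega>\<in>mdd_configs V W. mdd_weight V W V \<omega> * of_bool (Q \<omega>)) / mdd_partition V W"
proof -
  let ?C = "mdd_configs V W" and ?f = "\<lambda>\<omega>. mdd_weight V W V \<omega> / mdd_partition V W"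
  have fin: "finite ?C" by (rule finite_mdd_configs[OF assms(1)])
  have f: "?f \<omega> \<ge> 0" for \<omega>
    by (intro divide_nonneg_nonneg mdd_weight_nonneg mdd_partition_nonneg assms(2,3))
  have "emeasure (mdd_measure V W) {\<omega> \<in> space (mdd_measure V W). Q \<omega>}
      = (\<Sum>\<omega>\<in>{\<omega> \<in> ?C. Q \<omega>}. ennreal (?f \<omega>))"
    unfolding mdd_measure_def
    by (subst emeasure_point_measure_finite[OF fin]) (auto simp: space_point_measure)
  also have "\<dots> = ennreal (\<Sum>\<omega>\<in>{\<omega> \<in> ?C. Q \<omega>}. ?f \<omega>)"
    by (rule sum_ennreal) (rule f)
  finally have "\<P>(\<omega> in mdd_measure V W. Q \<omega>) = (\<Sum>\<omega>\<in>{\<omega> \<in> ?C. Q \<omega>}. ?f \<omega>)"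
    by (simp add: measure_def f sum_nonneg)
  also have "\<dots> = (\<Sum>\<omega>\<in>?C. ?f \<omega> * of_bool (Q \<omega>))"
    by (rule sum.mono_neutral_cong_left) (use fin in auto)
  finally show ?thesis by (simp add: sum_divide_distrib)
qed

text \<open>\<open>W_even\<close> includes the diagonal: monomers have weight zero, so only pairs of
  perfect matchings contribute.\<close>

locale torus_matching = circulant +
  fixes W :: "int \<Rightarrow> int \<Rightarrow> real"
  assumes W_sym: "W x y = W y x"
    and W_even: "even (x - y) \<Longrightarrow> W x y = 0"
    and W_A: "W (2 * i) (2 * j + 1) = a (j - i)"
begin

abbreviation V :: "int set" where "V \<equiv> torus (2 * N)"

abbreviation E :: "int set set" where "E \<equiv> mdd_edges V W"

lemma finite_V: "finite V"
  by (simp add: torus_def)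

lemma even_in_V [simp]: "2 * i \<in> V \<longleftrightarrow> i \<in> S"
  by (auto simp: torus_def S_def)

lemma odd_in_V [simp]: "2 * j + 1 \<in> V \<longleftrightarrow> j \<in> S"
  by (auto simp: torus_def S_def)

lemma V_cases:
  assumes "x \<in> V"
  obtains i where "i \<in> S" "x = 2 * i" | j where "j \<in> S" "x = 2 * j + 1"
  using assms by (cases "even x") (auto elim!: evenE oddE)

definition edge :: "int \<Rightarrow> int \<Rightarrow> int set" where
  "edge i j = {2 * i, 2 * j + 1}"

lemma edge_eq_iff [simp]: "edge i j = edge k l \<longleftrightarrow> i = k \<and> j = l"
proof -
  have "2 * i \<noteq> 2 * l + 1" by presburger
  then show ?thesis by (auto simp: edge_def doubleton_eq_iff)
qed

lemma edge_in_E: "edge i j \<in> E \<longleftrightarrow> i \<in> S \<and> j \<in> S \<and> A i j > 0"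
proof
  assume "edge i j \<in> E"
  then obtain x y where xy: "{2 * i, 2 * j + 1} = {x, y}" "x \<in> V" "y \<in> V" "W x y > 0"
    by (auto simp: mdd_edges_def edge_def)
  then have "x = 2 * i \<and> y = 2 * j + 1 \<or> x = 2 * j + 1 \<and> y = 2 * i"
    by (auto simp: doubleton_eq_iff)
  then show "i \<in> S \<and> j \<in> S \<and> A i j > 0"
    using xy(2-4) W_sym[of "2 * j + 1" "2 * i"] by (auto simp: W_A A_def)
next
  assume ij: "i \<in> S \<and> j \<in> S \<and> A i j > 0"
  moreover have "2 * i \<noteq> 2 * j + 1" by presburger
  ultimately show "edge i j \<in> E"
    unfolding mdd_edges_def edge_def
    by (intro CollectI exI[of _ "2 * i"] exI[of _ "2 * j + 1"]) (simp add: W_A A_def)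
qed

lemma E_cases:
  assumes "e \<in> E"
  obtains i j where "e = edge i j" "i \<in> S" "j \<in> S" "A i j > 0"
proof -
  obtain x y where e: "e = {x, y}" "x \<in> V" "y \<in> V" "W x y > 0"
    using assms by (auto simp: mdd_edges_def)
  have "odd (x - y)" using W_even[of x y] e(4) by auto
  then consider i j where "x = 2 * i" "y = 2 * j + 1" | i j where "y = 2 * i" "x = 2 * j + 1"
    by (cases "even x") (auto elim!: evenE oddE)
  then obtain i j where ij: "e = edge i j"
    by cases (use e(1) in \<open>auto simp: edge_def insert_commute\<close>)
  with assms edge_in_E[of i j] that show ?thesis by blast
qed

lemma edge_weight_edge: "edge_weight W (edge i j) = A i j"
  unfolding edge_def by (simp add: edge_weight_doubleton[OF W_sym] W_A A_def)

lemma even_neighbours: "{2 * i, y} \<in> E \<longleftrightarrow> (\<exists>j. y = 2 * j + 1 \<and> edge i j \<in> E)"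
proof
  assume *: "{2 * i, y} \<in> E"
  then obtain k j where kj: "{2 * i, y} = edge k j" by (rule E_cases)
  then have "k = i \<and> y = 2 * j + 1" unfolding edge_def doubleton_eq_iff by presburger
  then show "\<exists>j. y = 2 * j + 1 \<and> edge i j \<in> E" using * kj by auto
qed (auto simp: edge_def)

lemma odd_neighbours: "{2 * j + 1, y} \<in> E \<longleftrightarrow> (\<exists>i. y = 2 * i \<and> edge i j \<in> E)"
proof
  assume *: "{2 * j + 1, y} \<in> E"
  then obtain i l where il: "{2 * j + 1, y} = edge i l" by (rule E_cases)
  then have "l = j \<and> y = 2 * i" unfolding edge_def doubleton_eq_iff by presburger
  then show "\<exists>i. y = 2 * i \<and> edge i j \<in> E" using * il by auto
qed (auto simp: edge_def insert_commute)

lemma degree_even: "dimer_degree V W m (2 * i) = (\<Sum>j | edge i j \<in> E. m (edge i j))"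
proof -
  have "{y. {2 * i, y} \<in> E} = (\<lambda>j. 2 * j + 1) ` {j. edge i j \<in> E}"
    by (auto simp: even_neighbours)
  then show ?thesis by (simp add: dimer_degree_def sum.reindex inj_on_def edge_def)
qed

lemma degree_odd: "dimer_degree V W m (2 * j + 1) = (\<Sum>i | edge i j \<in> E. m (edge i j))"
proof -
  have "{y. {2 * j + 1, y} \<in> E} = (\<lambda>i. 2 * i) ` {i. edge i j \<in> E}"
    by (auto simp: odd_neighbours)
  then show ?thesis
    by (simp add: dimer_degree_def sum.reindex inj_on_def edge_def insert_commute)
qed

text \<open>The dimers that a permutation, viewed as a bijection from even to odd sites, places on the
  even sites in \<open>U\<close>.\<close>

definition dimers :: "int set \<Rightarrow> (int \<Rightarrow> int) \<Rightarrow> int set \<Rightarrow> nat" where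
  "dimers U \<sigma> = (\<lambda>e\<in>E. if \<exists>i\<in>U. e = edge i (\<sigma> i) then 1 else 0)"

text \<open>\<open>U\<close> is \<open>S\<close> for a perfect matching and \<open>S - {0}\<close>
  for the matching with two holes in the two-point function. Positive entries place every dimer on
  an edge of \<open>E\<close>.\<close>

definition admissible :: "int set \<Rightarrow> (int \<Rightarrow> int) \<Rightarrow> bool" where
  "admissible U \<sigma> \<longleftrightarrow> \<sigma> permutes S \<and> U \<subseteq> S \<and> (\<forall>i\<in>U. A i (\<sigma> i) > 0)"

lemma dimers_edge: "edge i j \<in> E \<Longrightarrow> dimers U \<sigma> (edge i j) = of_bool (i \<in> U \<and> j = \<sigma> i)"
  by (auto simp: dimers_def)

lemma admissible_edge: "admissible U \<sigma> \<Longrightarrow> i \<in> U \<Longrightarrow> edge i (\<sigma> i) \<in> E"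
  by (auto simp: admissible_def edge_in_E permutes_in_image)

lemma dimers_in_families: "dimers U \<sigma> \<in> dimer_families V W"
  by (auto simp: dimer_families_def dimers_def)

lemma finite_edge_ends: "finite {j. edge i j \<in> E}" "finite {i. edge i j \<in> E}"
  by (rule finite_subset[OF _ finite_S], auto simp: edge_in_E)+

lemma degree_dimers_even:
  assumes "admissible U \<sigma>"
  shows "dimer_degree V W (dimers U \<sigma>) (2 * i) = of_bool (i \<in> U)"
proof -
  have "dimer_degree V W (dimers U \<sigma>) (2 * i) = (\<Sum>j | edge i j \<in> E. if \<sigma> i = j then of_bool (i \<in> U) else 0)"
    unfolding degree_even by (rule sum.cong) (auto simp: dimers_edge)
  also have "\<dots> = of_bool (i \<in> U)"
    using admissible_edge[OF assms, of i] by (auto simp: sum.delta'[OF finite_edge_ends(1)] sum.delta[OF finite_edge_ends(1)])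
  finally show ?thesis .
qed

lemma degree_dimers_odd:
  assumes "admissible U \<sigma>"
  shows "dimer_degree V W (dimers U \<sigma>) (2 * j + 1) = of_bool (j \<in> \<sigma> ` U)"
proof -
  have \<sigma>: "\<sigma> permutes S" using assms by (simp add: admissible_def)
  have inv: "j = \<sigma> i \<longleftrightarrow> inv \<sigma> j = i" for i
    using permutes_inverses[OF \<sigma>] by metis
  have "dimer_degree V W (dimers U \<sigma>) (2 * j + 1)
      = (\<Sum>i | edge i j \<in> E. if inv \<sigma> j = i then of_bool (inv \<sigma> j \<in> U) else 0)"
    unfolding degree_odd by (rule sum.cong) (auto simp: dimers_edge inv)
  also have "\<dots> = of_bool (inv \<sigma> j \<in> U)"
    using admissible_edge[OF assms, of "inv \<sigma> j"] permutes_inverses(1)[OF \<sigma>]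
    by (auto simp: sum.delta'[OF finite_edge_ends(2)] sum.delta[OF finite_edge_ends(2)])
  also have "inv \<sigma> j \<in> U \<longleftrightarrow> j \<in> \<sigma> ` U"
    by (auto simp: image_iff inv)
  finally show ?thesis .
qed

lemma prod_edge_weight_dimers:
  assumes "admissible U \<sigma>"
  shows "(\<Prod>e\<in>E. edge_weight W e ^ dimers U \<sigma> e) = (\<Prod>i\<in>U. A i (\<sigma> i))"
proof -
  let ?e = "\<lambda>i. edge i (\<sigma> i)"
  have sub: "?e ` U \<subseteq> E" using admissible_edge[OF assms] by blast
  have "(\<Prod>e\<in>E. edge_weight W e ^ dimers U \<sigma> e) = (\<Prod>e\<in>?e ` U. edge_weight W e)"
    by (rule prod.mono_neutral_cong_right[OF finite_mdd_edges[OF finite_V] sub])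
       (auto simp: dimers_def admissible_edge[OF assms])
  also have "\<dots> = (\<Prod>i\<in>U. A i (\<sigma> i))"
    by (subst prod.reindex) (auto simp: inj_on_def edge_weight_edge)
  finally show ?thesis .
qed

lemma mdd_weight_dimers:
  assumes "admissible U \<sigma>" "admissible S \<tau>"
    and "\<And>z. z \<in> Z \<Longrightarrow> dimer_degree V W (dimers U \<sigma>) z = 1"
  shows "mdd_weight V W Z (dimers U \<sigma>, dimers S \<tau>) = perm_weight U A \<sigma> * wt \<tau>"
  using assms(3) prod_edge_weight_dimers[OF assms(1)] prod_edge_weight_dimers[OF assms(2)]
  by (simp add: mdd_weight_def power_add prod.distrib perm_weight_def wt_def)

text \<open>Permutations using a zero entry have no configuration, but also no weight, so they may
  be kept in or dropped from every sum.\<close>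

lemma admissible_iff: "admissible S \<sigma> \<longleftrightarrow> \<sigma> \<in> P \<and> wt \<sigma> \<noteq> 0"
proof (cases "\<sigma> \<in> P")
  case True
  have "wt \<sigma> \<noteq> 0 \<longleftrightarrow> (\<forall>i\<in>S. A i (\<sigma> i) > 0)"
    using A_nonneg by (auto simp: wt_def perm_weight_def order_less_le)
  then show ?thesis using True by (simp add: admissible_def P_def)
qed (simp add: admissible_def P_def)

lemma dimers_inj:
  assumes "admissible U \<sigma>" "admissible U \<tau>" "dimers U \<sigma> = dimers U \<tau>" "i \<in> U"
  shows "\<sigma> i = \<tau> i"
proof -
  have e: "edge i (\<sigma> i) \<in> E" by (rule admissible_edge[OF assms(1,4)])
  have "dimers U \<tau> (edge i (\<sigma> i)) = dimers U \<sigma> (edge i (\<sigma> i))" using assms(3) by simp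
  then show ?thesis using assms(4) by (simp add: dimers_edge[OF e] of_bool_def split: if_splits)
qed

section \<open>Weighted pairs of permutations as the dimer model\<close>

definition config :: "(int \<Rightarrow> int) \<times> (int \<Rightarrow> int) \<Rightarrow> (int set \<Rightarrow> nat) \<times> (int set \<Rightarrow> nat)" where
  "config \<omega> = (dimers S (fst \<omega>), dimers S (snd \<omega>))"

definition PA :: "((int \<Rightarrow> int) \<times> (int \<Rightarrow> int)) set" where
  "PA = {\<omega>. admissible S (fst \<omega>) \<and> admissible S (snd \<omega>)}"

lemma PA_subset: "PA \<subseteq> P \<times> P"
  by (auto simp: PA_def admissible_iff)

lemma degree_dimers_S:
  assumes "admissible S \<sigma>" "x \<in> V"
  shows "dimer_degree V W (dimers S \<sigma>) x = 1"
  using assms(2)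
proof (cases rule: V_cases)
  case (1 i)
  then show ?thesis using degree_dimers_even[OF assms(1)] by simp
next
  case (2 j)
  have "\<sigma> ` S = S" using assms(1) permutes_image by (auto simp: admissible_def)
  then show ?thesis using 2 degree_dimers_odd[OF assms(1)] by simp
qed

lemma config_in: "\<omega> \<in> PA \<Longrightarrow> config \<omega> \<in> mdd_configs V W"
  by (auto simp: PA_def config_def mdd_configs_def dimers_in_families degree_dimers_S)

lemma weight_config: "\<omega> \<in> PA \<Longrightarrow> mdd_weight V W V (config \<omega>) = wt2 \<omega>"
  using mdd_weight_dimers[of S "fst \<omega>" "snd \<omega>" V] degree_dimers_S
  by (simp add: PA_def config_def wt2_def) (simp add: wt_def)

lemma inj_config: "inj_on config PA"
proof (rule inj_onI)
  fix \<omega> \<omega>' assume w: "\<omega> \<in> PA" "\<omega>' \<in> PA" "config \<omega> = config \<omega>'"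
  have "\<sigma> = \<tau>" if "admissible S \<sigma>" "admissible S \<tau>" "dimers S \<sigma> = dimers S \<tau>" for \<sigma> \<tau>
  proof
    fix i
    show "\<sigma> i = \<tau> i"
      using dimers_inj[OF that, of i] that(1,2) permutes_not_in[of \<sigma> S i] permutes_not_in[of \<tau> S i]
      by (cases "i \<in> S") (auto simp: admissible_def)
  qed
  then show "\<omega> = \<omega>'" using w by (auto simp: PA_def config_def prod_eq_iff)
qed

text \<open>Degree 1 at the even sites defines the map, and degree 1 at the odd sites makes it
  injective.\<close>

lemma dimers_surj:
  assumes m: "m \<in> dimer_families V W" and deg: "\<And>x. x \<in> V \<Longrightarrow> dimer_degree V W m x = 1"
  shows "\<exists>\<sigma>. admissible S \<sigma> \<and> m = dimers S \<sigma>"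
proof -
  define p where "p i j \<longleftrightarrow> edge i j \<in> E \<and> m (edge i j) = 1" for i j
  have row: "(\<exists>j. p i j) \<and> (\<forall>j l. p i j \<longrightarrow> p i l \<longrightarrow> j = l)" if i: "i \<in> S" for i
  proof -
    have "(\<Sum>j | edge i j \<in> E. m (edge i j)) = 1"
      using deg[of "2 * i"] i by (simp only: degree_even even_in_V)
    then obtain j where j: "p i j" "\<And>l. edge i l \<in> E \<Longrightarrow> j \<noteq> l \<Longrightarrow> m (edge i l) = 0"
      by (auto simp only: sum_eq_1_iff[OF finite_edge_ends(1)] p_def mem_Collect_eq)
    have "l = j" if "p i l" for l
    proof (rule ccontr)
      assume "l \<noteq> j"
      then have "m (edge i l) = 0" by (intro j(2)) (use that p_def in auto)
      then show False using that by (simp add: p_def)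
    qed
    then show ?thesis using j(1) by metis
  qed
  have column: "i = k" if j: "j \<in> S" and ik: "p i j" "p k j" for i j k
  proof -
    have "(\<Sum>i | edge i j \<in> E. m (edge i j)) = 1"
      using deg[of "2 * j + 1"] j by (simp only: degree_odd odd_in_V)
    then obtain l where l: "\<And>k. edge k j \<in> E \<Longrightarrow> l \<noteq> k \<Longrightarrow> m (edge k j) = 0"
      by (auto simp only: sum_eq_1_iff[OF finite_edge_ends(2)] mem_Collect_eq)
    have "l = i" "l = k" using l[of i] l[of k] ik by (auto simp: p_def)
    then show ?thesis by simp
  qed
  define \<sigma> where "\<sigma> i = (if i \<in> S then SOME j. p i j else i)" for i
  have s: "p i (\<sigma> i)" if "i \<in> S" for i
    using row[OF that] that someI_ex[of "p i"] by (simp add: \<sigma>_def)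
  have \<sigma>S: "\<sigma> i \<in> S" if "i \<in> S" for i
    using s[OF that] by (simp add: p_def edge_in_E)
  have "inj_on \<sigma> S"
  proof (rule inj_onI)
    fix i k assume ik: "i \<in> S" "k \<in> S" "\<sigma> i = \<sigma> k"
    show "i = k" using column[OF \<sigma>S[OF ik(1)] s[OF ik(1)]] s[OF ik(2)] ik(3) by simp
  qed
  moreover have "\<sigma> ` S \<subseteq> S" using \<sigma>S by blast
  ultimately have "bij_betw \<sigma> S S"
    by (simp add: bij_betw_def endo_inj_surj)
  then have \<sigma>: "\<sigma> permutes S" by (rule bij_imp_permutes) (simp add: \<sigma>_def)
  have adm: "admissible S \<sigma>"
    using \<sigma> s by (auto simp: admissible_def p_def edge_in_E)
  have "m = dimers S \<sigma>"
  proof (rule PiE_ext)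
    show "m \<in> E \<rightarrow>\<^sub>E {0, 1}" "dimers S \<sigma> \<in> E \<rightarrow>\<^sub>E {0, 1}"
      using m dimers_in_families[of S \<sigma>] by (simp_all add: dimer_families_def)
    fix e assume e: "e \<in> E"
    then obtain i j where ij: "e = edge i j" "i \<in> S" by (rule E_cases)
    then show "m e = dimers S \<sigma> e"
      using ij(2)
    proof (cases "j = \<sigma> i")
      case True
      then show ?thesis using s[OF ij(2)] e ij by (simp add: dimers_edge p_def)
    next
      case False
      have "\<not> p i j"
      proof
        assume "p i j"
        then have "j = \<sigma> i" using row[OF ij(2)] s[OF ij(2)] by metis
        then show False using False by simp
      qed
      moreover have "m e \<in> {0, 1}" using m e unfolding dimer_families_def by (rule PiE_mem)
      ultimately show ?thesis using False e ij by (auto simp: dimers_edge p_def)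
    qed
  qed
  then show ?thesis using adm by blast
qed

text \<open>A vertex of degree 0 would contribute the factor \<open>W x x = 0\<close>, so nonzero
  weight forces degree 1 everywhere.\<close>

lemma nonzero_config:
  assumes "\<omega> \<in> mdd_configs V W" "mdd_weight V W V \<omega> \<noteq> 0"
  shows "\<omega> \<in> config ` PA"
proof -
  obtain m1 m2 where \<omega>: "\<omega> = (m1, m2)" by (cases \<omega>)
  have m: "m1 \<in> dimer_families V W" "m2 \<in> dimer_families V W"
    and deg: "\<And>x. x \<in> V \<Longrightarrow> dimer_degree V W m1 x = dimer_degree V W m2 x \<and> dimer_degree V W m1 x \<in> {0, 1}"
    using assms(1) by (auto simp: \<omega> mdd_configs_def)
  have "(\<Prod>z\<in>V. W z z ^ (1 - dimer_degree V W m1 z)) \<noteq> 0"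
    using assms(2) by (auto simp: \<omega> mdd_weight_def)
  then have "W x x ^ (1 - dimer_degree V W m1 x) \<noteq> 0" if "x \<in> V" for x
    using that finite_V by (simp add: prod_zero_iff)
  then have nz: "dimer_degree V W m1 x \<noteq> 0" if "x \<in> V" for x
    using that W_even[of x x] by force
  have deg1: "dimer_degree V W m1 x = 1" "dimer_degree V W m2 x = 1" if "x \<in> V" for x
    using deg[OF that] nz[OF that] by auto
  from dimers_surj[OF m(1) deg1(1)] dimers_surj[OF m(2) deg1(2)]
  obtain \<sigma> \<tau> where "admissible S \<sigma>" "m1 = dimers S \<sigma>" "admissible S \<tau>" "m2 = dimers S \<tau>"
    by blast
  then show ?thesis by (intro image_eqI[of _ _ "(\<sigma>, \<tau>)"]) (simp_all add: \<omega> config_def PA_def)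
qed

lemma sum_configs:
  "(\<Sum>\<omega>\<in>mdd_configs V W. mdd_weight V W V \<omega> * f \<omega>) = (\<Sum>\<omega>\<in>PA. wt2 \<omega> * f (config \<omega>))"
proof -
  have "(\<Sum>\<omega>\<in>mdd_configs V W. mdd_weight V W V \<omega> * f \<omega>)
      = (\<Sum>\<omega>\<in>config ` PA. mdd_weight V W V \<omega> * f \<omega>)"
  proof (rule sum.mono_neutral_right)
    show "finite (mdd_configs V W)" by (rule finite_mdd_configs[OF finite_V])
    show "config ` PA \<subseteq> mdd_configs V W" using config_in by blast
    show "\<forall>\<omega>\<in>mdd_configs V W - config ` PA. mdd_weight V W V \<omega> * f \<omega> = 0"
      using nonzero_config by fastforce
  qed
  also have "\<dots> = (\<Sum>\<omega>\<in>PA. wt2 \<omega> * f (config \<omega>))"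
    by (simp add: sum.reindex[OF inj_config] weight_config)
  finally show ?thesis .
qed

lemma sum_PA: "(\<Sum>\<omega>\<in>P \<times> P. wt2 \<omega> * f \<omega>) = (\<Sum>\<omega>\<in>PA. wt2 \<omega> * f \<omega>)"
  by (rule sum.mono_neutral_right) (use PA_subset in \<open>auto simp: PA_def admissible_iff wt2_def\<close>)

lemma mdd_partition_eq: "mdd_partition V W = per\<^sup>2"
  using sum_configs[of "\<lambda>_. 1"] sum_PA[of "\<lambda>_. 1"] by (simp add: mdd_partition_def per_square)

lemma prob_ge:
  assumes "\<And>\<omega>. \<omega> \<in> PA \<Longrightarrow> Q \<omega> \<Longrightarrow> Q' (config \<omega>)"
  shows "(\<Sum>\<omega>\<in>P \<times> P. wt2 \<omega> * of_bool (Q \<omega>)) / per\<^sup>2 \<le> \<P>(\<omega> in mdd_measure V W. Q' \<omega>)"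
proof -
  have "(\<Sum>\<omega>\<in>PA. wt2 \<omega> * of_bool (Q \<omega>)) \<le> (\<Sum>\<omega>\<in>PA. wt2 \<omega> * of_bool (Q' (config \<omega>)))"
    by (intro sum_mono mult_left_mono wt2_nonneg) (use assms in auto)
  then show ?thesis
    by (simp add: prob_mdd_measure[OF finite_V W_sym] W_even sum_PA sum_configs
        mdd_partition_eq divide_right_mono)
qed

text \<open>The even sites of the loop form a balanced set, hence contain the cluster. Each has one
  dimer of \<open>\<sigma>\<close> and one of \<open>\<tau>\<close>, counted separately even on a
  doubled edge; this is the factor 2.\<close>

lemma loop_length_ge:
  assumes "\<omega> \<in> PA" "i \<in> S"
  shows "2 * card (cl \<omega> i) \<le> mdd_loop_length V W (config \<omega>) (2 * i)"
proof -
  obtain \<sigma> \<tau> where \<omega>: "\<omega> = (\<sigma>, \<tau>)" by (cases \<omega>)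
  have adm: "admissible S \<sigma>" "admissible S \<tau>" using assms(1) by (auto simp: PA_def \<omega>)
  then have perm: "\<sigma> permutes S" "\<tau> permutes S" by (auto simp: admissible_def)
  define r where "r = {(u, v). {u, v} \<in> E \<and> dimers S \<sigma> {u, v} + dimers S \<tau> {u, v} > 0}"
  define Lp where "Lp = mdd_loop V W (config \<omega>) (2 * i)"
  have Lp: "Lp = {y. (2 * i, y) \<in> r\<^sup>*}" by (simp add: Lp_def mdd_loop_def config_def \<omega> r_def)
  have step: "2 * k \<in> Lp \<longleftrightarrow> 2 * \<rho> k + 1 \<in> Lp" if "k \<in> S" and \<rho>: "\<rho> = \<sigma> \<or> \<rho> = \<tau>" for k \<rho>
  proof -
    have e: "edge k (\<rho> k) \<in> E" using admissible_edge that adm by blast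
    then have "dimers S \<sigma> (edge k (\<rho> k)) + dimers S \<tau> (edge k (\<rho> k)) > 0"
      using that by (auto simp: dimers_edge)
    then have "(2 * k, 2 * \<rho> k + 1) \<in> r" "(2 * \<rho> k + 1, 2 * k) \<in> r"
      using e by (simp_all add: r_def edge_def insert_commute)
    then show ?thesis unfolding Lp by (auto intro: rtrancl_into_rtrancl)
  qed
  define X where "X = {k \<in> S. 2 * k \<in> Lp}"
  have img: "\<rho> ` X = {j \<in> S. 2 * j + 1 \<in> Lp}" if "\<rho> permutes S" "\<rho> = \<sigma> \<or> \<rho> = \<tau>" for \<rho>
  proof (intro equalityI subsetI)
    fix j assume "j \<in> \<rho> ` X"
    then show "j \<in> {j \<in> S. 2 * j + 1 \<in> Lp}"
      using step[OF _ that(2)] permutes_in_image[OF that(1)] by (auto simp: X_def)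
  next
    fix j assume j: "j \<in> {j \<in> S. 2 * j + 1 \<in> Lp}"
    moreover have "\<rho> ` S = S" by (rule permutes_image[OF that(1)])
    ultimately obtain k where "k \<in> S" "j = \<rho> k" by blast
    then show "j \<in> \<rho> ` X" using j step[OF _ that(2)] by (auto simp: X_def)
  qed
  have "balanced S \<sigma> \<tau> X" using img perm by (auto simp: balanced_def X_def)
  moreover have "i \<in> X" using assms(2) by (simp add: X_def Lp)
  ultimately have "cl \<omega> i \<subseteq> X" unfolding cl_def \<omega> by (simp add: cluster_subset)
  moreover have "finite X" by (simp add: X_def)
  ultimately have "card (cl \<omega> i) \<le> card X" by (rule card_mono[rotated])
  moreover have "card X \<le> (\<Sum>e | e \<in> E \<and> e \<subseteq> Lp. dimers S \<rho> e)" if "admissible S \<rho>" "\<rho> = \<sigma> \<or> \<rho> = \<tau>" for \<rho>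
  proof -
    let ?e = "\<lambda>k. edge k (\<rho> k)"
    have sub: "?e ` X \<subseteq> {e. e \<in> E \<and> e \<subseteq> Lp}"
      using admissible_edge[OF that(1)] step[OF _ that(2)] by (auto simp: X_def edge_def)
    have "card X = (\<Sum>k\<in>X. dimers S \<rho> (?e k))"
      using admissible_edge[OF that(1)] by (simp add: X_def dimers_edge)
    also have "\<dots> = (\<Sum>e\<in>?e ` X. dimers S \<rho> e)"
      by (subst sum.reindex) (auto simp: inj_on_def)
    also have "\<dots> \<le> (\<Sum>e | e \<in> E \<and> e \<subseteq> Lp. dimers S \<rho> e)"
      by (rule sum_mono2[OF _ sub]) (use finite_mdd_edges[OF finite_V, of W] in auto)
    finally show ?thesis .
  qed
  from this[OF adm(1)] this[OF adm(2)]
  have "2 * card X \<le> (\<Sum>e | e \<in> E \<and> e \<subseteq> Lp. dimers S \<sigma> e) + (\<Sum>e | e \<in> E \<and> e \<subseteq> Lp. dimers S \<tau> e)"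
    by simp
  moreover have "mdd_loop_length V W (config \<omega>) (2 * i)
      = (\<Sum>e | e \<in> E \<and> e \<subseteq> Lp. dimers S \<sigma> e) + (\<Sum>e | e \<in> E \<and> e \<subseteq> Lp. dimers S \<tau> e)"
    unfolding Lp_def by (simp add: mdd_loop_length_def config_def \<omega> sum.distrib)
  ultimately show ?thesis by linarith
qed

lemma max_loop_length_ge:
  assumes "\<omega> \<in> PA" "i \<in> S"
  shows "2 * card (cl \<omega> i) \<le> mdd_max_loop_length V W (config \<omega>)"
proof -
  have "mdd_loop_length V W (config \<omega>) (2 * i) \<le> mdd_max_loop_length V W (config \<omega>)"
    unfolding mdd_max_loop_length_def by (rule Max_ge) (use finite_V assms(2) in auto)
  then show ?thesis using loop_length_ge[OF assms] by linarith
qed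

text \<open>The first matching leaves the sites 0 and \<open>2 * j + 1\<close> free and yields the
  minor; the second is perfect and yields \<open>per\<close>. These pairs inject into the two-point
  configurations.\<close>

lemma two_point_ge:
  assumes j: "j \<in> S"
  shows "minor 0 j * per / per\<^sup>2 \<le> mdd_two_point V W 0 (2 * j + 1)"
proof -
  \<comment> \<open>Row 0 is exempt from positivity: no dimer is placed from 0 to
    \<open>2 * j + 1\<close>, and that edge may be absent.\<close>
  define M where "M = {\<sigma>. admissible (S - {0}) \<sigma> \<and> \<sigma> 0 = j}"
  define T where "T = {\<tau>. admissible S \<tau>}"
  define g where "g = (\<lambda>(\<sigma>, \<tau>). (dimers (S - {0}) \<sigma>, dimers S \<tau>))"
  let ?C = "mdd_two_point_configs V W 0 (2 * j + 1)"
  have degV: "dimer_degree V W (dimers (S - {0}) \<sigma>) z = of_bool (z \<noteq> 0 \<and> z \<noteq> 2 * j + 1)"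
    if "\<sigma> \<in> M" "z \<in> V" for \<sigma> z
    using that(2)
  proof (cases rule: V_cases)
    case (1 i)
    have "2 * i \<noteq> 2 * j + 1" by presburger
    then show ?thesis using 1 that(1) degree_dimers_even[of "S - {0}" \<sigma> i] by (simp add: M_def)
  next
    case (2 l)
    have \<sigma>: "\<sigma> permutes S" "\<sigma> 0 = j" using that(1) by (auto simp: M_def admissible_def)
    have "\<sigma> ` (S - {0}) = S - {j}"
      using image_set_diff[OF permutes_inj[OF \<sigma>(1)], of S "{0}"] permutes_image[OF \<sigma>(1)] \<sigma>(2) by simp
    moreover have "2 * l + 1 \<noteq> 0" by presburger
    ultimately show ?thesis using 2 that(1) degree_dimers_odd[of "S - {0}" \<sigma> l] by (simp add: M_def)
  qed
  have in_C: "g x \<in> ?C" if x: "x \<in> M \<times> T" for x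
  proof -
    obtain \<sigma> \<tau> where st: "x = (\<sigma>, \<tau>)" "\<sigma> \<in> M" "admissible S \<tau>" using x by (auto simp: T_def)
    have "0 \<in> V" "2 * j + 1 \<in> V" using j even_in_V[of 0] by auto
    then show ?thesis
      using degV[OF st(2)] degree_dimers_S[OF st(3)]
      by (auto simp: st(1) g_def mdd_two_point_configs_def dimers_in_families)
  qed
  have weight: "mdd_weight V W (V - {0, 2 * j + 1}) (g x) = perm_weight (S - {0}) A (fst x) * wt (snd x)"
    if x: "x \<in> M \<times> T" for x
    using x mdd_weight_dimers[of "S - {0}" "fst x" "snd x" "V - {0, 2 * j + 1}"] degV[of "fst x"]
    by (auto simp: g_def M_def T_def)
  have "inj_on g (M \<times> T)"
  proof (rule inj_onI)
    fix x y assume xy: "x \<in> M \<times> T" "y \<in> M \<times> T" "g x = g y"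
    obtain \<sigma> \<tau> \<sigma>' \<tau>' where st: "x = (\<sigma>, \<tau>)" "y = (\<sigma>', \<tau>')" by (cases x, cases y)
    have m: "\<sigma> \<in> M" "\<sigma>' \<in> M" "admissible S \<tau>" "admissible S \<tau>'"
      using xy by (auto simp: st T_def)
    have eq: "dimers (S - {0}) \<sigma> = dimers (S - {0}) \<sigma>'" "dimers S \<tau> = dimers S \<tau>'"
      using xy(3) by (auto simp: st g_def)
    have "\<sigma> k = \<sigma>' k" for k
      using dimers_inj[of "S - {0}" \<sigma> \<sigma>' k] eq(1) m(1,2) permutes_not_in[of \<sigma> S k] permutes_not_in[of \<sigma>' S k]
      by (cases "k \<in> S - {0}") (auto simp: M_def admissible_def)
    moreover have "\<tau> k = \<tau>' k" for k
      using dimers_inj[of S \<tau> \<tau>' k] eq(2) m(3,4) permutes_not_in[of \<tau> S k] permutes_not_in[of \<tau>' S k]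
      by (cases "k \<in> S") (auto simp: admissible_def)
    ultimately show "x = y" by (auto simp: st)
  qed
  note inj = this
  have "minor 0 j = (\<Sum>\<sigma>\<in>M. perm_weight (S - {0}) A \<sigma>)"
    unfolding permanent_minor_def
  proof (rule sum.mono_neutral_right)
    show "finite {\<sigma>. \<sigma> permutes S \<and> \<sigma> 0 = j}"
      by (rule finite_subset[OF _ finite_P]) (auto simp: P_def)
    show "M \<subseteq> {\<sigma>. \<sigma> permutes S \<and> \<sigma> 0 = j}" by (auto simp: M_def admissible_def)
    show "\<forall>\<sigma>\<in>{\<sigma>. \<sigma> permutes S \<and> \<sigma> 0 = j} - M. perm_weight (S - {0}) A \<sigma> = 0"
    proof
      fix \<sigma> assume "\<sigma> \<in> {\<sigma>. \<sigma> permutes S \<and> \<sigma> 0 = j} - M"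
      then obtain i where "i \<in> S - {0}" "\<not> A i (\<sigma> i) > 0"
        by (auto simp: M_def admissible_def)
      moreover from this have "A i (\<sigma> i) = 0" using A_nonneg[of i "\<sigma> i"] by linarith
      ultimately show "perm_weight (S - {0}) A \<sigma> = 0"
        unfolding perm_weight_def by (intro prod_zero) auto
    qed
  qed
  moreover have "per = (\<Sum>\<tau>\<in>T. wt \<tau>)"
    unfolding per_eq by (rule sum.mono_neutral_right) (auto simp: T_def admissible_iff)
  ultimately have "minor 0 j * per = (\<Sum>x\<in>M \<times> T. perm_weight (S - {0}) A (fst x) * wt (snd x))"
    by (simp add: sum_product sum.cartesian_product case_prod_beta)
  also have "\<dots> = (\<Sum>\<omega>\<in>g ` (M \<times> T). mdd_weight V W (V - {0, 2 * j + 1}) \<omega>)"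
    by (simp add: sum.reindex[OF inj] weight)
  also have "\<dots> \<le> (\<Sum>\<omega>\<in>?C. mdd_weight V W (V - {0, 2 * j + 1}) \<omega>)"
    by (rule sum_mono2[OF finite_mdd_two_point_configs[OF finite_V]])
       (use in_C in \<open>auto intro!: mdd_weight_nonneg[OF W_sym] simp: W_even\<close>)
  finally have "minor 0 j * per \<le> (\<Sum>\<omega>\<in>?C. mdd_weight V W (V - {0, 2 * j + 1}) \<omega>)" .
  moreover have "0 \<noteq> 2 * j + 1" by presburger
  ultimately show ?thesis
    by (simp add: mdd_two_point_def mdd_partition_eq divide_right_mono)
qed

lemma sum_two_point_ge:
  "(\<Sum>j\<in>S. minor 0 j) * per / per\<^sup>2 \<le> (\<Sum>x\<in>V. mdd_two_point V W 0 x)"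
proof -
  have "(\<Sum>j\<in>S. minor 0 j) * per / per\<^sup>2 = (\<Sum>j\<in>S. minor 0 j * per / per\<^sup>2)"
    by (simp add: sum_distrib_right sum_divide_distrib)
  also have "\<dots> \<le> (\<Sum>j\<in>S. mdd_two_point V W 0 (2 * j + 1))"
    by (rule sum_mono) (rule two_point_ge)
  also have "\<dots> = (\<Sum>x\<in>(\<lambda>j. 2 * j + 1) ` S. mdd_two_point V W 0 x)"
    by (subst sum.reindex) (auto simp: inj_on_def)
  also have "\<dots> \<le> (\<Sum>x\<in>V. mdd_two_point V W 0 x)"
    by (rule sum_mono2[OF finite_V]) (auto intro!: mdd_two_point_nonneg[OF W_sym] simp: W_even)
  finally show ?thesis .
qed

end

lemma torus_matching_periodised:
  assumes nonneg: "\<And>r. w r \<ge> 0" and symmetric: "\<And>r. w r = w (- r)"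
    and normalised: "(w has_sum 1) UNIV" and bipartite: "\<And>r. even r \<Longrightarrow> w r = 0"
    and "N > 0"
  shows "torus_matching N (circ w N) (periodised_weight w (2 * N))"
proof -
  interpret circulant N "circ w N" using assms by (intro circulant_circ)
  show ?thesis
  proof
    show "periodised_weight w (2 * N) x y = periodised_weight w (2 * N) y x" for x y
      by (rule periodised_weight_uminus) (rule symmetric)
    show "periodised_weight w (2 * N) x y = 0" if "even (x - y)" for x y
    proof -
      have "w (y - x + k * int (2 * N)) = 0" for k
        by (rule bipartite) (use that in auto)
      then show ?thesis unfolding periodised_weight_def by simp
    qed
    have "2 * j + 1 - 2 * i = 2 * (j - i) + 1 - 0" for i j :: int by simp
    then show "periodised_weight w (2 * N) (2 * i) (2 * j + 1) = circ w N (j - i)" for i j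
      unfolding circ_def periodised_weight_def by (simp only:)
  qed
qed

section \<open>Quantitative bounds on a single torus\<close>

context torus_matching
begin

lemma torus_bounds:
  assumes u: "a u \<ge> b" "b > 0" and R: "tail R * (4 * sqrt 2 / b) \<le> 1" "R \<ge> 1"
  defines "\<epsilon> \<equiv> 1 / (2 * R)"
  shows prob_max_loop_ge:
      "1 / 16 \<le> \<P>(\<omega> in mdd_measure V W. \<epsilon> * real (2 * N) \<le> real (mdd_max_loop_length V W \<omega>))"
    and prob_loop_zero_ge:
      "\<epsilon> / 16 \<le> \<P>(\<omega> in mdd_measure V W. \<epsilon> * real (2 * N) \<le> real (mdd_loop_length V W \<omega> 0))"
    and mean_two_point_ge:
      "\<epsilon>\<^sup>2 / 32 \<le> (\<Sum>x\<in>V. mdd_two_point V W 0 x) / real (2 * N)"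
proof -
  \<comment> \<open>\<open>K\<close> counts rows; with two dimers per row it corresponds to a loop
    length of \<open>\<epsilon> * (2 * N)\<close>.\<close>
  define K where "K = \<epsilon> * real N"
  have per: "per > 0" using per_pos[of u] u by linarith
  have K: "K > 0" "K = real N / (2 * R)" using R(2) N_pos by (auto simp: K_def \<epsilon>_def)
  have macro: "per\<^sup>2 / 16 \<le> (\<Sum>\<omega>\<in>P \<times> P. wt2 \<omega> * of_bool (macro K \<omega>))"
    unfolding K(2) by (rule macro_weight[OF u R])
  have "1 / 16 = per\<^sup>2 / 16 / per\<^sup>2" using per by simp
  also have "\<dots> \<le> (\<Sum>\<omega>\<in>P \<times> P. wt2 \<omega> * of_bool (macro K \<omega>)) / per\<^sup>2"
    by (rule divide_right_mono[OF macro]) simp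
  also have "\<dots> \<le> \<P>(\<omega> in mdd_measure V W. \<epsilon> * real (2 * N) \<le> real (mdd_max_loop_length V W \<omega>))"
  proof (rule prob_ge)
    fix \<omega> assume \<omega>: "\<omega> \<in> PA" "macro K \<omega>"
    obtain i where i: "i \<in> S" "K \<le> real (card (cl \<omega> i))" using macro_imp_cluster[OF \<omega>(2)] by blast
    have "real (2 * card (cl \<omega> i)) \<le> real (mdd_max_loop_length V W (config \<omega>))"
      using max_loop_length_ge[OF \<omega>(1) i(1)] by (rule of_nat_mono)
    then show "\<epsilon> * real (2 * N) \<le> real (mdd_max_loop_length V W (config \<omega>))"
      using i(2) by (simp add: K_def)
  qed
  finally show "1 / 16 \<le> \<P>(\<omega> in mdd_measure V W. \<epsilon> * real (2 * N) \<le> real (mdd_max_loop_length V W \<omega>))" .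
  let ?s = "\<Sum>\<omega>\<in>P \<times> P. wt2 \<omega> * of_bool (K \<le> real (card (cl \<omega> 0)))"
  have "K * (per\<^sup>2 / 16) \<le> K * (\<Sum>\<omega>\<in>P \<times> P. wt2 \<omega> * of_bool (macro K \<omega>))"
    by (rule mult_left_mono[OF macro]) (use K in simp)
  also have "\<dots> \<le> real N * ?s" by (rule macro_zero) (use K in simp)
  finally have s: "\<epsilon> / 16 * per\<^sup>2 \<le> ?s" using N_pos by (simp add: K_def)
  then have "\<epsilon> / 16 \<le> ?s / per\<^sup>2" using per by (simp add: le_divide_eq)
  also have "\<dots> \<le> \<P>(\<omega> in mdd_measure V W. \<epsilon> * real (2 * N) \<le> real (mdd_loop_length V W \<omega> 0))"
  proof (rule prob_ge)
    fix \<omega> assume \<omega>: "\<omega> \<in> PA" "K \<le> real (card (cl \<omega> 0))"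
    have "real (2 * card (cl \<omega> 0)) \<le> real (mdd_loop_length V W (config \<omega>) (2 * 0))"
      using loop_length_ge[OF \<omega>(1) zero_in_S] by (rule of_nat_mono)
    then show "\<epsilon> * real (2 * N) \<le> real (mdd_loop_length V W (config \<omega>) 0)"
      using \<omega>(2) by (simp add: K_def)
  qed
  finally show "\<epsilon> / 16 \<le> \<P>(\<omega> in mdd_measure V W. \<epsilon> * real (2 * N) \<le> real (mdd_loop_length V W \<omega> 0))" .
  \<comment> \<open>The expected cluster size is at least \<open>K\<close> times the tail just
    bounded. With \<open>K = \<epsilon> * N\<close>, division by \<open>2 * N\<close> gives
    \<open>\<epsilon>\<^sup>2 / 32\<close>.\<close>
  have "K * (\<epsilon> / 16 * per\<^sup>2) \<le> K * ?s" by (rule mult_left_mono[OF s]) (use K in simp)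
  also have "\<dots> \<le> (\<Sum>\<omega>\<in>P \<times> P. wt2 \<omega> * real (card (cl \<omega> 0)))"
    unfolding sum_distrib_left[of K]
  proof (rule sum_mono)
    fix \<omega>
    have "K * of_bool (K \<le> real (card (cl \<omega> 0))) \<le> real (card (cl \<omega> 0))" by simp
    from mult_left_mono[OF this wt2_nonneg[of \<omega>]]
    show "K * (wt2 \<omega> * of_bool (K \<le> real (card (cl \<omega> 0)))) \<le> wt2 \<omega> * real (card (cl \<omega> 0))"
      by (simp only: mult_ac)
  qed
  also have "\<dots> \<le> per * (\<Sum>j\<in>S. minor 0 j)" by (rule sum_minor_ge[OF zero_in_S])
  finally have "K * (\<epsilon> / 16) \<le> (\<Sum>j\<in>S. minor 0 j) * per / per\<^sup>2"
    using per by (simp add: le_divide_eq mult_ac)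
  also have "\<dots> \<le> (\<Sum>x\<in>V. mdd_two_point V W 0 x)" by (rule sum_two_point_ge)
  finally show "\<epsilon>\<^sup>2 / 32 \<le> (\<Sum>x\<in>V. mdd_two_point V W 0 x) / real (2 * N)"
    using N_pos by (simp add: K_def le_divide_eq power2_eq_square mult_ac)
qed

end

theorem theorem3p8:
  fixes w :: "int \<Rightarrow> real"
  assumes nonneg: "\<And>r. w r \<ge> 0"
    and symmetric: "\<And>r. w r = w (- r)"
    and normalised: "(w has_sum 1) UNIV"
    and bipartite: "\<And>r. even r \<Longrightarrow> w r = 0"
    and first_moment: "(\<lambda>r. \<bar>real_of_int r\<bar> * w r) summable_on UNIV"
  shows "\<exists>\<epsilon>>0. \<exists>c>0. \<forall>L::nat. even L \<and> L > 0 \<longrightarrow>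
     \<P>(\<omega> in mdd_measure (torus L) (periodised_weight w L).
          real (mdd_max_loop_length (torus L) (periodised_weight w L) \<omega>) \<ge> \<epsilon> * real L) \<ge> c \<and>
     \<P>(\<omega> in mdd_measure (torus L) (periodised_weight w L).
          real (mdd_loop_length (torus L) (periodised_weight w L) \<omega> 0) \<ge> \<epsilon> * real L) \<ge> \<epsilon> * c \<and>
     mdd_mean_two_point L w \<ge> c"
proof -
  obtain R b u where R: "R \<ge> 1" and b: "b > 0"
    and bounds: "\<And>N. N > 0 \<Longrightarrow> circ w N u \<ge> b \<and> circulant.tail N (circ w N) R * (4 * sqrt 2 / b) \<le> 1"
    using circ_constants[OF assms] by blast
  define \<epsilon> where "\<epsilon> = 1 / (2 * R)"
  have \<epsilon>: "0 < \<epsilon>" "\<epsilon> \<le> 1" using R by (auto simp: \<epsilon>_def)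
  show ?thesis
  proof (rule exI[of _ \<epsilon>], intro conjI, rule \<epsilon>(1), rule exI[of _ "\<epsilon>\<^sup>2 / 32"], intro conjI allI impI)
    show "\<epsilon>\<^sup>2 / 32 > 0" using \<epsilon> by simp
    \<comment> \<open>The mean two-point function has the weakest of the three bounds; as
      \<open>\<epsilon> \<le> 1\<close>, its constant also serves the two probabilities.\<close>
    have c: "\<epsilon>\<^sup>2 / 32 \<le> 1 / 16"
      using power_le_one[of \<epsilon> 2] \<epsilon> by simp
    have c': "\<epsilon> * (\<epsilon>\<^sup>2 / 32) \<le> \<epsilon> / 16"
      using mult_left_mono[OF c, of \<epsilon>] \<epsilon> by simp
    fix L :: nat assume L: "even L \<and> L > 0"
    then obtain N where N: "L = 2 * N" "N > 0" by (auto elim: evenE)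
    interpret torus_matching N "circ w N" "periodised_weight w (2 * N)"
      by (rule torus_matching_periodised[OF nonneg symmetric normalised bipartite N(2)])
    note B = bounds[OF N(2), THEN conjunct1] b bounds[OF N(2), THEN conjunct2] R
    show "\<P>(\<omega> in mdd_measure (torus L) (periodised_weight w L).
          real (mdd_max_loop_length (torus L) (periodised_weight w L) \<omega>) \<ge> \<epsilon> * real L) \<ge> \<epsilon>\<^sup>2 / 32"
      using prob_max_loop_ge[OF B] c unfolding N(1) \<epsilon>_def by linarith
    show "\<P>(\<omega> in mdd_measure (torus L) (periodised_weight w L).
          real (mdd_loop_length (torus L) (periodised_weight w L) \<omega> 0) \<ge> \<epsilon> * real L) \<ge> \<epsilon> * (\<epsilon>\<^sup>2 / 32)"
      using prob_loop_zero_ge[OF B] c' unfolding N(1) \<epsilon>_def by linarith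
    show "mdd_mean_two_point L w \<ge> \<epsilon>\<^sup>2 / 32"
      using mean_two_point_ge[OF B] unfolding N(1) \<epsilon>_def mdd_mean_two_point_def by simp
  qed
qed

end
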